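(* Let $(A,\circ,[\cdot,\cdot])$ be a Gel'fand-Dorfman algebra and $(V,l_A,r_A,\rho_A)$ a representation of it. Let $\hat A=A\ltimes_{l_A^\ast+r_A^\ast,-r_A^\ast,\rho_A^\ast}V^\ast$ be the semi-direct product Gel'fand-Dorfman algebra with operations $\bullet$ and $[\cdot,\cdot]$. Let $T:V\to A$ be a linear map, identified with $r_T\in A\otimes V^\ast\subseteq \hat A\otimes\hat A$ through $\mathrm{Hom}_{\mathbf{k}}(V,A)\cong A\otimes V^\ast$. Then $r=r_T-\tau r_T$ is a solution of the Gel'fand-Dorfman Yang-Baxter equation in $(\hat A,\bullet,[\cdot,\cdot])$ if and only if $T$ is an $\mathcal{O}$-operator on $(A,\circ,[\cdot,\cdot])$ associated to $(V,l_A,r_A,\rho_A)$.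
   Context: Conventions: $\mathbf{k}$ is a field of characteristic $0$; vector spaces over $\mathbf{k}$ are finite-dimensional; $\otimes=\otimes_{\mathbf{k}}$; $\tau(a\otimes b)=b\otimes a$; $a\star b=a\circ b+b\circ a$. A Novikov algebra $(A,\circ)$ satisfies $(a\circ b)\circ c-a\circ(b\circ c)=(b\circ a)\circ c-b\circ(a\circ c)$ and $(a\circ b)\circ c=(a\circ c)\circ b$. A Gel'fand-Dorfman (GD) algebra $(A,\circ,[\cdot,\cdot])$ is a Novikov algebra $(A,\circ)$ and a Lie algebra $(A,[\cdot,\cdot])$ with $[a\circ b,c]-[a\circ c,b]+[a,b]\circ c-[a,c]\circ b-a\circ[b,c]=0$ for all $a,b,c$. A representation $(V,l_A,r_A,\rho_A)$ of a GD algebra $A$: $l_A,r_A,\rho_A:A\to\mathrm{End}_{\mathbf{k}}(V)$ linear, $\rho_A$ a representation of the Lie algebra $(A,[\cdot,\cdot])$, and for all $a,b\in A$, $v\in V$: $l_A(a\circ b-b\circ a)v=l_A(a)l_A(b)v-l_A(b)l_A(a)v$; $l_A(a)r_A(b)v-r_A(b)l_A(a)v=r_A(a\circ b)v-r_A(b)r_A(a)v$; $l_A(a\circ b)v=r_A(b)l_A(a)v$; $r_A(a)r_A(b)v=r_A(b)r_A(a)v$; $\rho_A(a)l_A(b)v+\rho_A(b\circ a)v+l_A([b,a])v-r_A(a)\rho_A(b)v-l_A(b)\rho_A(a)v=0$; $\rho_A(a)r_A(b)v-\rho_A(b)r_A(a)v-r_A(b)\rho_A(a)v+r_A(a)\rho_A(b)v-r_A([a,b])v=0$.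 For a linear map $\varphi:A\to\mathrm{End}_{\mathbf{k}}(V)$, $\varphi^\ast:A\to\mathrm{End}_{\mathbf{k}}(V^\ast)$ is $\langle\varphi^\ast(a)f,u\rangle=-\langle f,\varphi(a)u\rangle$. If $(V,l_A,r_A,\rho_A)$ is a representation of $A$, then so is $(V^\ast,l_A^\ast+r_A^\ast,-r_A^\ast,\rho_A^\ast)$. For a representation $(W,l,r,\rho)$ of $A$, the semi-direct product $A\ltimes_{l,r,\rho}W$ is the GD algebra on $A\oplus W$ with $(a+u)\bullet(b+v)=a\circ b+l(a)v+r(b)u$ and $[a+u,b+v]=[a,b]+\rho(a)v-\rho(b)u$. Under $\mathrm{Hom}_{\mathbf{k}}(V,A)\cong A\otimes V^\ast$, $T$ corresponds to $r_T=\sum_i T(v_i)\otimes v_i^\ast$ for a basis $\{v_i\}$ of $V$ with dual basis $\{v_i^\ast\}$. The Gel'fand-Dorfman Yang-Baxter equation (GDYBE) in a GD algebra $(B,\circ,[\cdot,\cdot])$ for $r=\sum_\alpha x_\alpha\otimes y_\alpha\in B\otimes B$ is $\mathbf{N}(r)=\mathbf{C}(r)=0$, where $\mathbf{N}(r)=\sum_{\alpha,\beta}\big(x_\alpha\otimes x_\beta\otimes y_\alpha\circ y_\beta+x_\alpha\otimes y_\alpha\star x_\beta\otimes y_\beta+x_\alpha\circ x_\beta\otimes y_\beta\otimes y_\alpha\big)$, $\mathbf{C}(r)=\sum_{\alpha,\beta}\big([x_\alpha,x_\beta]\otimes y_\alpha\otimes y_\beta+x_\alpha\otimes[y_\alpha,x_\beta]\otimes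 y_\beta+x_\alpha\otimes x_\beta\otimes[y_\alpha,y_\beta]\big)$. A linear map $T:V\to A$ is an $\mathcal{O}$-operator on $(A,\circ,[\cdot,\cdot])$ associated to $(V,l_A,r_A,\rho_A)$ if for all $u,v\in V$: $T(u)\circ T(v)=T(l_A(T(u))v+r_A(T(v))u)$ and $[T(u),T(v)]=T(\rho_A(T(u))v-\rho_A(T(v))u)$. *)

theory Defs
  imports Complex_Main "HOL-Library.Poly_Mapping" "HOL-Library.Function_Algebras"
    "HOL-Library.Product_Plus"
begin

section \<open>Gel'fand-Dorfman algebras and their representations\<close>

text \<open>The vector space underlying an algebra is a subspace of a vector space type, because the dual
  of a vector space is not a type of its own: it is a subspace of the type of all functions into
  the field.\<close>

definition linear_on ::
    "('k \<Rightarrow> 'a \<Rightarrow> 'a) \<Rightarrow> ('k \<Rightarrow> 'b \<Rightarrow> 'b) \<Rightarrow> 'a set \<Rightarrow> 'b set \<Rightarrow> ('a::ab_group_add \<Rightarrow> 'b::ab_group_add) \<Rightarrow> bool"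
  where "linear_on s1 s2 U W f \<longleftrightarrow>
    (\<forall>x\<in>U. f x \<in> W) \<and> (\<forall>x\<in>U. \<forall>y\<in>U. f (x + y) = f x + f y) \<and> (\<forall>c. \<forall>x\<in>U. f (s1 c x) = s2 c (f x))"

definition bilinear_on ::
    "('k \<Rightarrow> 'a \<Rightarrow> 'a) \<Rightarrow> ('k \<Rightarrow> 'b \<Rightarrow> 'b) \<Rightarrow> ('k \<Rightarrow> 'c \<Rightarrow> 'c) \<Rightarrow> 'a set \<Rightarrow> 'b set \<Rightarrow> 'c set \<Rightarrow>
      ('a::ab_group_add \<Rightarrow> 'b::ab_group_add \<Rightarrow> 'c::ab_group_add) \<Rightarrow> bool"
  where "bilinear_on s1 s2 s3 U V W f \<longleftrightarrow>
    (\<forall>x\<in>U. linear_on s2 s3 V W (f x)) \<and> (\<forall>y\<in>V. linear_on s1 s3 U W (\<lambda>x. f x y))"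

locale gd_algebra = vector_space scale
  for scale :: "'k::field \<Rightarrow> 'a::ab_group_add \<Rightarrow> 'a" +
  fixes A :: "'a set"
    and circ :: "'a \<Rightarrow> 'a \<Rightarrow> 'a" (infixl \<open>\<circ>\<^sub>A\<close> 70)
    and br :: "'a \<Rightarrow> 'a \<Rightarrow> 'a"
  assumes subspace_A: "subspace A"
    and bilinear_circ: "bilinear_on scale scale scale A A A circ"
    and left_symmetric: "\<lbrakk>a \<in> A; b \<in> A; c \<in> A\<rbrakk> \<Longrightarrow>
      (a \<circ>\<^sub>A b) \<circ>\<^sub>A c - a \<circ>\<^sub>A (b \<circ>\<^sub>A c) = (b \<circ>\<^sub>A a) \<circ>\<^sub>A c - b \<circ>\<^sub>A (a \<circ>\<^sub>A c)"
    and right_commutative: "\<lbrakk>a \<in> A; b \<in> A; c \<in> A\<rbrakk> \<Longrightarrow> (a \<circ>\<^sub>A b) \<circ>\<^sub>A c = (a \<circ>\<^sub>A c) \<circ>\<^sub>A b"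
    and bilinear_br: "bilinear_on scale scale scale A A A br"
    and br_self: "a \<in> A \<Longrightarrow> br a a = 0"
    and jacobi: "\<lbrakk>a \<in> A; b \<in> A; c \<in> A\<rbrakk> \<Longrightarrow> br a (br b c) + br b (br c a) + br c (br a b) = 0"
    and compatible: "\<lbrakk>a \<in> A; b \<in> A; c \<in> A\<rbrakk> \<Longrightarrow>
      br (a \<circ>\<^sub>A b) c - br (a \<circ>\<^sub>A c) b + br a b \<circ>\<^sub>A c - br a c \<circ>\<^sub>A b - a \<circ>\<^sub>A br b c = 0"

locale gd_representation = gd_algebra scaleA A circ br + V: vector_space scaleV
  for scaleA :: "'k::field \<Rightarrow> 'a::ab_group_add \<Rightarrow> 'a"
    and A :: "'a set"
    and circ :: "'a \<Rightarrow> 'a \<Rightarrow> 'a" (infixl \<open>\<circ>\<^sub>A\<close> 70)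
    and br :: "'a \<Rightarrow> 'a \<Rightarrow> 'a"
    and scaleV :: "'k \<Rightarrow> 'v::ab_group_add \<Rightarrow> 'v" +
  fixes V :: "'v set"
    and l :: "'a \<Rightarrow> 'v \<Rightarrow> 'v"
    and r :: "'a \<Rightarrow> 'v \<Rightarrow> 'v"
    and \<rho> :: "'a \<Rightarrow> 'v \<Rightarrow> 'v"
  assumes subspace_V: "V.subspace V"
    and bilinear_l: "bilinear_on scaleA scaleV scaleV A V V l"
    and bilinear_r: "bilinear_on scaleA scaleV scaleV A V V r"
    and bilinear_rho: "bilinear_on scaleA scaleV scaleV A V V \<rho>"
    and lie_representation: "\<lbrakk>a \<in> A; b \<in> A; v \<in> V\<rbrakk> \<Longrightarrow> \<rho> (br a b) v = \<rho> a (\<rho> b v) - \<rho> b (\<rho> a v)"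
    and rep_left_symmetric: "\<lbrakk>a \<in> A; b \<in> A; v \<in> V\<rbrakk> \<Longrightarrow>
      l (a \<circ>\<^sub>A b - b \<circ>\<^sub>A a) v = l a (l b v) - l b (l a v)"
    and rep_mixed: "\<lbrakk>a \<in> A; b \<in> A; v \<in> V\<rbrakk> \<Longrightarrow>
      l a (r b v) - r b (l a v) = r (a \<circ>\<^sub>A b) v - r b (r a v)"
    and rep_l_circ: "\<lbrakk>a \<in> A; b \<in> A; v \<in> V\<rbrakk> \<Longrightarrow> l (a \<circ>\<^sub>A b) v = r b (l a v)"
    and rep_r_commute: "\<lbrakk>a \<in> A; b \<in> A; v \<in> V\<rbrakk> \<Longrightarrow> r a (r b v) = r b (r a v)"
    and rep_compatible_l: "\<lbrakk>a \<in> A; b \<in> A; v \<in> V\<rbrakk> \<Longrightarrow>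
      \<rho> a (l b v) + \<rho> (b \<circ>\<^sub>A a) v + l (br b a) v - r a (\<rho> b v) - l b (\<rho> a v) = 0"
    and rep_compatible_r: "\<lbrakk>a \<in> A; b \<in> A; v \<in> V\<rbrakk> \<Longrightarrow>
      \<rho> a (r b v) - \<rho> b (r a v) - r b (\<rho> a v) + r a (\<rho> b v) - r (br a b) v = 0"

definition o_operator ::
    "('k::field \<Rightarrow> 'v \<Rightarrow> 'v) \<Rightarrow> ('k \<Rightarrow> 'a \<Rightarrow> 'a) \<Rightarrow> ('a \<Rightarrow> 'a \<Rightarrow> 'a) \<Rightarrow> ('a \<Rightarrow> 'a \<Rightarrow> 'a) \<Rightarrow>
      ('a \<Rightarrow> 'v \<Rightarrow> 'v) \<Rightarrow> ('a \<Rightarrow> 'v \<Rightarrow> 'v) \<Rightarrow> ('a \<Rightarrow> 'v \<Rightarrow> 'v) \<Rightarrow>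
      ('v::ab_group_add \<Rightarrow> 'a::ab_group_add) \<Rightarrow> bool"
  where "o_operator scaleV scaleA circ br l r \<rho> T \<longleftrightarrow>
    Vector_Spaces.linear scaleV scaleA T \<and>
    (\<forall>u v. circ (T u) (T v) = T (l (T u) v + r (T v) u)) \<and>
    (\<forall>u v. br (T u) (T v) = T (\<rho> (T u) v - \<rho> (T v) u))"


section \<open>Dual space and semi-direct product\<close>

definition dual_space :: "('k::field \<Rightarrow> 'v::ab_group_add \<Rightarrow> 'v) \<Rightarrow> ('v \<Rightarrow> 'k) set"
  where "dual_space scaleV = {f. Vector_Spaces.linear scaleV (*) f}"

definition dual_scale :: "'k::field \<Rightarrow> ('v \<Rightarrow> 'k) \<Rightarrow> ('v \<Rightarrow> 'k)"
  where "dual_scale c f = (\<lambda>u. c * f u)"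

definition dual_basis :: "('k::field \<Rightarrow> 'v::ab_group_add \<Rightarrow> 'v) \<Rightarrow> 'v set \<Rightarrow> 'v \<Rightarrow> ('v \<Rightarrow> 'k)"
  where "dual_basis scaleV Basis v = (\<lambda>u. module.representation scaleV Basis u v)"

definition dual_map :: "('a \<Rightarrow> 'v \<Rightarrow> 'v) \<Rightarrow> 'a \<Rightarrow> ('v \<Rightarrow> 'k::field) \<Rightarrow> ('v \<Rightarrow> 'k)"
  where "dual_map \<phi> a f = (\<lambda>u. - f (\<phi> a u))"

definition sd_scale ::
    "('k \<Rightarrow> 'a \<Rightarrow> 'a) \<Rightarrow> ('k \<Rightarrow> 'w \<Rightarrow> 'w) \<Rightarrow> 'k \<Rightarrow> 'a \<times> 'w \<Rightarrow> 'a \<times> 'w"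
  where "sd_scale scaleA scaleW c x = (scaleA c (fst x), scaleW c (snd x))"

definition sd_circ ::
    "('a \<Rightarrow> 'a \<Rightarrow> 'a) \<Rightarrow> ('a \<Rightarrow> 'w \<Rightarrow> 'w) \<Rightarrow> ('a \<Rightarrow> 'w \<Rightarrow> 'w) \<Rightarrow>
      'a \<times> 'w::ab_group_add \<Rightarrow> 'a \<times> 'w \<Rightarrow> 'a \<times> 'w"
  where "sd_circ circ l r x y =
    (circ (fst x) (fst y), l (fst x) (snd y) + r (fst y) (snd x))"

definition sd_br ::
    "('a \<Rightarrow> 'a \<Rightarrow> 'a) \<Rightarrow> ('a \<Rightarrow> 'w \<Rightarrow> 'w) \<Rightarrow> 'a \<times> 'w::ab_group_add \<Rightarrow> 'a \<times> 'w \<Rightarrow> 'a \<times> 'w"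
  where "sd_br br \<rho> x y =
    (br (fst x) (fst y), \<rho> (fst x) (snd y) - \<rho> (fst y) (snd x))"


section \<open>The tensor products $B\otimes B$ and $B\otimes B\otimes B$\<close>

text \<open>A tensor is a coset, in the space of formal linear combinations of pairs (triples) of
  elements of \<open>B\<close>, of the subspace spanned by the multilinearity relations.
  \<open>Poly_Mapping.single t c\<close> is the formal multiple $c\,t$.\<close>

definition free_scale :: "'k::field \<Rightarrow> ('t \<Rightarrow>\<^sub>0 'k) \<Rightarrow> ('t \<Rightarrow>\<^sub>0 'k)"
  where "free_scale c p = Poly_Mapping.map ((*) c) p"

definition free_space :: "'t set \<Rightarrow> ('t \<Rightarrow>\<^sub>0 'k::field) set"
  where "free_space X = {p. Poly_Mapping.keys p \<subseteq> X}"

definition null2 :: "('k::field \<Rightarrow> 'b::ab_group_add \<Rightarrow> 'b) \<Rightarrow> 'b set \<Rightarrow> (('b \<times> 'b) \<Rightarrow>\<^sub>0 'k) set"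
  where "null2 scale B = module.span free_scale (
    {Poly_Mapping.single (x + x', y) 1 - Poly_Mapping.single (x, y) 1 - Poly_Mapping.single (x', y) 1
      | x x' y. x \<in> B \<and> x' \<in> B \<and> y \<in> B} \<union>
    {Poly_Mapping.single (x, y + y') 1 - Poly_Mapping.single (x, y) 1 - Poly_Mapping.single (x, y') 1
      | x y y'. x \<in> B \<and> y \<in> B \<and> y' \<in> B} \<union>
    {Poly_Mapping.single (scale c x, y) 1 - Poly_Mapping.single (x, y) c | c x y. x \<in> B \<and> y \<in> B} \<union>
    {Poly_Mapping.single (x, scale c y) 1 - Poly_Mapping.single (x, y) c | c x y. x \<in> B \<and> y \<in> B})"

definition null3 :: "('k::field \<Rightarrow> 'b::ab_group_add \<Rightarrow> 'b) \<Rightarrow> 'b set \<Rightarrow> (('b \<times> 'b \<times> 'b) \<Rightarrow>\<^sub>0 'k) set"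
  where "null3 scale B = module.span free_scale (
    {Poly_Mapping.single (x + x', y, z) 1 - Poly_Mapping.single (x, y, z) 1
        - Poly_Mapping.single (x', y, z) 1
      | x x' y z. x \<in> B \<and> x' \<in> B \<and> y \<in> B \<and> z \<in> B} \<union>
    {Poly_Mapping.single (x, y + y', z) 1 - Poly_Mapping.single (x, y, z) 1
        - Poly_Mapping.single (x, y', z) 1
      | x y y' z. x \<in> B \<and> y \<in> B \<and> y' \<in> B \<and> z \<in> B} \<union>
    {Poly_Mapping.single (x, y, z + z') 1 - Poly_Mapping.single (x, y, z) 1
        - Poly_Mapping.single (x, y, z') 1
      | x y z z'. x \<in> B \<and> y \<in> B \<and> z \<in> B \<and> z' \<in> B} \<union>
    {Poly_Mapping.single (scale c x, y, z) 1 - Poly_Mapping.single (x, y, z) c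
      | c x y z. x \<in> B \<and> y \<in> B \<and> z \<in> B} \<union>
    {Poly_Mapping.single (x, scale c y, z) 1 - Poly_Mapping.single (x, y, z) c
      | c x y z. x \<in> B \<and> y \<in> B \<and> z \<in> B} \<union>
    {Poly_Mapping.single (x, y, scale c z) 1 - Poly_Mapping.single (x, y, z) c
      | c x y z. x \<in> B \<and> y \<in> B \<and> z \<in> B})"

definition tensor2 ::
    "('k::field \<Rightarrow> 'b::ab_group_add \<Rightarrow> 'b) \<Rightarrow> 'b set \<Rightarrow> (('b \<times> 'b) \<Rightarrow>\<^sub>0 'k) \<Rightarrow> (('b \<times> 'b) \<Rightarrow>\<^sub>0 'k) set"
  where "tensor2 scale B p = (\<lambda>n. p + n) ` null2 scale B"

definition tensor3 ::
    "('k::field \<Rightarrow> 'b::ab_group_add \<Rightarrow> 'b) \<Rightarrow> 'b set \<Rightarrow> (('b \<times> 'b \<times> 'b) \<Rightarrow>\<^sub>0 'k) \<Rightarrow>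
      (('b \<times> 'b \<times> 'b) \<Rightarrow>\<^sub>0 'k) set"
  where "tensor3 scale B p = (\<lambda>n. p + n) ` null3 scale B"

definition tensor_space2 ::
    "('k::field \<Rightarrow> 'b::ab_group_add \<Rightarrow> 'b) \<Rightarrow> 'b set \<Rightarrow> (('b \<times> 'b) \<Rightarrow>\<^sub>0 'k) set set"
  where "tensor_space2 scale B = tensor2 scale B ` free_space (B \<times> B)"

text \<open>The difference of two cosets, and the image of a coset under the flip $\tau$.\<close>

definition tensor_diff :: "('t \<Rightarrow>\<^sub>0 'k::field) set \<Rightarrow> ('t \<Rightarrow>\<^sub>0 'k) set \<Rightarrow> ('t \<Rightarrow>\<^sub>0 'k) set"
  where "tensor_diff P Q = {p - q | p q. p \<in> P \<and> q \<in> Q}"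

definition tensor_flip :: "(('b \<times> 'b) \<Rightarrow>\<^sub>0 'k::field) set \<Rightarrow> (('b \<times> 'b) \<Rightarrow>\<^sub>0 'k) set"
  where "tensor_flip P = Poly_Mapping.map_key prod.swap ` P"


section \<open>The Gel'fand-Dorfman Yang-Baxter equation\<close>

text \<open>A list \<open>ps\<close> of pairs $(x_\alpha,y_\alpha)$ stands for the expression
  $\sum_\alpha x_\alpha\otimes y_\alpha$.\<close>

definition sum_tensor ::
    "('k::field \<Rightarrow> 'b::ab_group_add \<Rightarrow> 'b) \<Rightarrow> 'b set \<Rightarrow> ('b \<times> 'b) list \<Rightarrow> (('b \<times> 'b) \<Rightarrow>\<^sub>0 'k) set"
  where "sum_tensor scale B ps = tensor2 scale B (\<Sum>(x, y)\<leftarrow>ps. Poly_Mapping.single (x, y) 1)"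

definition N_tensor ::
    "('k::field \<Rightarrow> 'b::ab_group_add \<Rightarrow> 'b) \<Rightarrow> 'b set \<Rightarrow> ('b \<Rightarrow> 'b \<Rightarrow> 'b) \<Rightarrow> ('b \<times> 'b) list \<Rightarrow>
      (('b \<times> 'b \<times> 'b) \<Rightarrow>\<^sub>0 'k) set"
  where "N_tensor scale B circ ps = tensor3 scale B
    (\<Sum>(x, y)\<leftarrow>ps. \<Sum>(x', y')\<leftarrow>ps.
        Poly_Mapping.single (x, x', circ y y') 1
      + Poly_Mapping.single (x, circ y x' + circ x' y, y') 1
      + Poly_Mapping.single (circ x x', y', y) 1)"

definition C_tensor ::
    "('k::field \<Rightarrow> 'b::ab_group_add \<Rightarrow> 'b) \<Rightarrow> 'b set \<Rightarrow> ('b \<Rightarrow> 'b \<Rightarrow> 'b) \<Rightarrow> ('b \<times> 'b) list \<Rightarrow>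
      (('b \<times> 'b \<times> 'b) \<Rightarrow>\<^sub>0 'k) set"
  where "C_tensor scale B br ps = tensor3 scale B
    (\<Sum>(x, y)\<leftarrow>ps. \<Sum>(x', y')\<leftarrow>ps.
        Poly_Mapping.single (br x x', y, y') 1
      + Poly_Mapping.single (x, br y x', y') 1
      + Poly_Mapping.single (x, x', br y y') 1)"

text \<open>For bilinear operations on \<open>B\<close>, the classes \<open>N_tensor\<close> and \<open>C_tensor\<close> depend only on the tensor
  that \<open>ps\<close> represents, and every tensor has such a representation. So it makes no difference
  whether the equations are asked of one representation or, as here, of all of them.\<close>

definition gdybe_solution ::
    "('k::field \<Rightarrow> 'b::ab_group_add \<Rightarrow> 'b) \<Rightarrow> 'b set \<Rightarrow> ('b \<Rightarrow> 'b \<Rightarrow> 'b) \<Rightarrow> ('b \<Rightarrow> 'b \<Rightarrow> 'b) \<Rightarrow>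
      (('b \<times> 'b) \<Rightarrow>\<^sub>0 'k) set \<Rightarrow> bool"
  where "gdybe_solution scale B circ br r \<longleftrightarrow>
    r \<in> tensor_space2 scale B \<and>
    (\<forall>ps. set ps \<subseteq> B \<times> B \<and> sum_tensor scale B ps = r \<longrightarrow>
      N_tensor scale B circ ps = tensor3 scale B 0 \<and>
      C_tensor scale B br ps = tensor3 scale B 0)"

text \<open>The image in $\hat A\otimes\hat A$, for $\hat A=A\oplus V^\ast$, of the element
  $\sum_i T(v_i)\otimes v_i^\ast$ of $A\otimes V^\ast$.\<close>

definition hom_tensor ::
    "('k::field \<Rightarrow> 'a::ab_group_add \<Rightarrow> 'a) \<Rightarrow> ('k \<Rightarrow> 'v::ab_group_add \<Rightarrow> 'v) \<Rightarrow> 'v set \<Rightarrow> ('v \<Rightarrow> 'a) \<Rightarrow>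
      ((('a \<times> ('v \<Rightarrow> 'k)) \<times> ('a \<times> ('v \<Rightarrow> 'k))) \<Rightarrow>\<^sub>0 'k) set"
  where "hom_tensor scaleA scaleV Basis T =
    tensor2 (sd_scale scaleA dual_scale) (UNIV \<times> dual_space scaleV)
      (\<Sum>v\<in>Basis. Poly_Mapping.single ((T v, 0), (0, dual_basis scaleV Basis v)) 1)"

end

theory Submission
  imports Defs
begin

text \<open>The equation says that two elements \<open>N(r)\<close> and \<open>C(r)\<close> of a threefold tensor product vanish. In finite
  dimension a tensor vanishes iff all products \<open>f \<otimes> g \<otimes> h\<close> of functionals kill it
  (\<open>null3I\<close>, \<open>tensor3_eq_0_iff\<close>), so the equation can be tested on such products.

  Applied to \<open>N(r)\<close>, where each term multiplies one leg from each of two copies of \<open>r\<close>, the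
  functionals contract the remaining legs. With \<open>P f = (f \<otimes> id) r\<close> and \<open>Q f = (id \<otimes> f) r\<close> this gives
  \<open>h (P f \<bullet> P g) + g (P f \<bullet> Q h + Q h \<bullet> P f) + f (Q h \<bullet> Q g)\<close>, and similarly for \<open>C(r)\<close>
  (\<open>gdybe_solution_iff\<close>). These values involve \<open>r\<close> only through \<open>P\<close> and \<open>Q\<close>, which depend only
  on the tensor and not on the expression chosen for it.

  A functional on \<open>A \<oplus> V\<^sup>*\<close> is a pair \<open>(\<alpha>, u)\<close> of a functional \<open>\<alpha>\<close> on \<open>A\<close> and a vector \<open>u\<close> of \<open>V\<close>. For
  \<open>r = r\<^sub>T - \<tau> r\<^sub>T\<close> one finds \<open>P (\<alpha>, u) = (- T u, \<alpha> \<circ> T)\<close> and \<open>Q = - P\<close> (\<open>contract_skew_pairs\<close>).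
  Let \<open>D u v = T u \<circ> T v - T (l (T u) v + r (T v) u)\<close> be the defect of \<open>T\<close> for the Novikov
  product. Substituting in the formula above, for \<open>f = (\<alpha>, u)\<close>, \<open>g = (\<beta>, w)\<close>, \<open>h = (\<gamma>, z)\<close>, gives
  \<open>\<gamma> (D u w) + \<alpha> (D z w) - \<beta> (D u z + D z u)\<close> (\<open>N_value\<close>); the bracket gives such a formula with
  its own defect (\<open>C_value\<close>). If the defects vanish, so do these values. Conversely, the choice
  \<open>\<alpha> = \<beta> = 0\<close> with \<open>\<gamma>\<close> arbitrary forces every defect to vanish.\<close>


section \<open>Formal linear combinations\<close>

lemma lookup_free_scale [simp]: "Poly_Mapping.lookup (free_scale c p) t = c * Poly_Mapping.lookup p t"
  unfolding free_scale_def by (simp add: Poly_Mapping.map.rep_eq when_def)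

interpretation free: vector_space "free_scale :: 'k::field \<Rightarrow> ('t \<Rightarrow>\<^sub>0 'k) \<Rightarrow> _"
  by unfold_locales (auto intro!: poly_mapping_eqI simp: lookup_add algebra_simps)

lemma free_scale_single [simp]:
  "free_scale c (Poly_Mapping.single t d) = Poly_Mapping.single t (c * d)"
  by (rule poly_mapping_eqI) (simp add: lookup_single when_def)

definition linear_extension :: "('t \<Rightarrow> 'k::field) \<Rightarrow> ('t \<Rightarrow>\<^sub>0 'k) \<Rightarrow> 'k"
  where "linear_extension F p = (\<Sum>t\<in>Poly_Mapping.keys p. Poly_Mapping.lookup p t * F t)"

lemma linear_extension_superset:
  assumes "finite S" "Poly_Mapping.keys p \<subseteq> S"
  shows "linear_extension F p = (\<Sum>t\<in>S. Poly_Mapping.lookup p t * F t)"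
  unfolding linear_extension_def using assms
  by (intro sum.mono_neutral_left) (auto simp: in_keys_iff)

lemma linear_extension_0 [simp]: "linear_extension F 0 = 0"
  by (simp add: linear_extension_def)

lemma linear_extension_add:
  "linear_extension F (p + q) = linear_extension F p + linear_extension F q"
proof -
  let ?S = "Poly_Mapping.keys p \<union> Poly_Mapping.keys q"
  have "Poly_Mapping.keys (p + q) \<subseteq> ?S" by (rule keys_add)
  then show ?thesis
    by (simp add: linear_extension_superset[of ?S] lookup_add distrib_right sum.distrib)
qed

lemma linear_extension_scale:
  "linear_extension F (free_scale c p) = c * linear_extension F p"
proof -
  have "Poly_Mapping.keys (free_scale c p) \<subseteq> Poly_Mapping.keys p"
    by (auto simp: in_keys_iff)
  then show ?thesis
    by (simp add: linear_extension_superset[of "Poly_Mapping.keys p"] sum_distrib_left mult.assoc)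
qed

lemma linear_extension_diff:
  "linear_extension F (p - q) = linear_extension F p - linear_extension F q"
  by (metis add_diff_cancel diff_add_cancel linear_extension_add)

lemma linear_extension_single [simp]:
  "linear_extension F (Poly_Mapping.single t c) = c * F t"
  by (simp add: linear_extension_def lookup_single)

lemma linear_extension_sum_list:
  "linear_extension F (\<Sum>i\<leftarrow>is. p i) = (\<Sum>i\<leftarrow>is. linear_extension F (p i))"
  by (induction "is") (auto simp: linear_extension_add)

lemma keys_sum_list:
  "(\<And>i. i \<in> set is \<Longrightarrow> Poly_Mapping.keys (p i) \<subseteq> X) \<Longrightarrow> Poly_Mapping.keys (\<Sum>i\<leftarrow>is. p i) \<subseteq> X"
  by (induction "is") (auto dest!: set_mp[OF keys_add])

lemma linear_extension_zero_on_span: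
  assumes "p \<in> free.span G" "\<And>q. q \<in> G \<Longrightarrow> linear_extension F q = 0"
  shows "linear_extension F p = 0"
  using assms(1)
proof (induction rule: free.span_induct_alt)
  case (step c x y)
  then show ?case using assms(2) by (simp add: linear_extension_add linear_extension_scale)
qed simp

lemma sum_of_terms:
  "p = (\<Sum>t\<in>Poly_Mapping.keys p. free_scale (Poly_Mapping.lookup p t) (Poly_Mapping.single t 1))"
  by (rule poly_mapping_eqI)
    (simp add: lookup_sum lookup_single when_def sum.delta' in_keys_iff if_distrib cong: if_cong)


section \<open>Tensors and functionals\<close>

lemma linear_onD:
  assumes "linear_on s1 s2 U W f"
  shows "x \<in> U \<Longrightarrow> f x \<in> W"
    and "x \<in> U \<Longrightarrow> y \<in> U \<Longrightarrow> f (x + y) = f x + f y"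
    and "x \<in> U \<Longrightarrow> f (s1 c x) = s2 c (f x)"
  using assms by (auto simp: linear_on_def)

lemma bilinear_onD:
  assumes "bilinear_on s1 s2 s3 U V W f"
  shows "x \<in> U \<Longrightarrow> linear_on s2 s3 V W (f x)"
    and "y \<in> V \<Longrightarrow> linear_on s1 s3 U W (\<lambda>x. f x y)"
  using assms by (auto simp: bilinear_on_def)

text \<open>If \<open>\<phi>\<close> is linear modulo a subspace \<open>N\<close>, it maps linear combinations to linear combinations
  modulo \<open>N\<close>. It is used with \<open>\<phi>\<close> the insertion of a vector in one slot of a pure tensor.\<close>

lemma linear_modulo_sum:
  fixes \<phi> :: "'b::ab_group_add \<Rightarrow> ('t \<Rightarrow>\<^sub>0 'k::field)"
  assumes "vector_space scale" "module.subspace scale B" "free.subspace N"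
    and add: "\<And>x y. x \<in> B \<Longrightarrow> y \<in> B \<Longrightarrow> \<phi> (x + y) - \<phi> x - \<phi> y \<in> N"
    and scl: "\<And>c x. x \<in> B \<Longrightarrow> \<phi> (scale c x) - free_scale c (\<phi> x) \<in> N"
    and "finite I" "\<And>i. i \<in> I \<Longrightarrow> e i \<in> B"
  shows "\<phi> (\<Sum>i\<in>I. scale (c i) (e i)) - (\<Sum>i\<in>I. free_scale (c i) (\<phi> (e i))) \<in> N"
proof -
  interpret b: vector_space scale by fact
  have B0: "0 \<in> B" and Bscale: "\<And>c x. x \<in> B \<Longrightarrow> scale c x \<in> B"
    using assms(2) by (auto simp: b.subspace_def)
  show ?thesis
    using \<open>finite I\<close> \<open>\<And>i. i \<in> I \<Longrightarrow> e i \<in> B\<close>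
  proof (induction I)
    case empty
    show ?case using scl[OF B0, of 0] by simp
  next
    case (insert i I)
    let ?S = "\<Sum>i\<in>I. scale (c i) (e i)" and ?R = "\<Sum>i\<in>I. free_scale (c i) (\<phi> (e i))"
    have IH: "\<phi> ?S - ?R \<in> N" using insert by auto
    have "?S \<in> B" using insert.prems assms(2) by (auto intro!: b.subspace_sum Bscale)
    then have 1: "\<phi> (scale (c i) (e i) + ?S) - \<phi> (scale (c i) (e i)) - \<phi> ?S \<in> N"
      using insert.prems by (intro add Bscale) auto
    have 2: "\<phi> (scale (c i) (e i)) - free_scale (c i) (\<phi> (e i)) \<in> N"
      using insert.prems by (intro scl) auto
    have "(\<phi> (scale (c i) (e i) + ?S) - \<phi> (scale (c i) (e i)) - \<phi> ?S)
        + (\<phi> (scale (c i) (e i)) - free_scale (c i) (\<phi> (e i))) + (\<phi> ?S - ?R) \<in> N"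
      using 1 2 IH assms(3) by (intro free.subspace_add) auto
    then show ?case using insert.hyps by (simp add: algebra_simps)
  qed
qed

locale tensor_factor = vector_space scale
  for scale :: "'k::field \<Rightarrow> 'b::ab_group_add \<Rightarrow> 'b" +
  fixes B :: "'b set"
  assumes subspace_B: "subspace B"
begin

abbreviation functional :: "('b \<Rightarrow> 'k) \<Rightarrow> bool"
  where "functional f \<equiv> linear_on scale (*) B UNIV f"

abbreviation null2B where "null2B \<equiv> null2 scale B"
abbreviation null3B where "null3B \<equiv> null3 scale B"

lemma subspace_null: "free.subspace null2B" "free.subspace null3B"
  unfolding null2_def null3_def by (rule free.subspace_span)+

text \<open>The defining relations of \<open>B \<otimes> B \<otimes> B\<close> one by one, so that each can be cited for the slot it
  concerns.\<close>

lemma null3_relations: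
  fixes x y z x' y' z' :: 'b and c :: 'k
  assumes B: "x \<in> B" "y \<in> B" "z \<in> B"
  shows "x' \<in> B \<Longrightarrow> Poly_Mapping.single (x + x', y, z) 1 - Poly_Mapping.single (x, y, z) 1
      - Poly_Mapping.single (x', y, z) 1 \<in> null3B"
    and "y' \<in> B \<Longrightarrow> Poly_Mapping.single (x, y + y', z) 1 - Poly_Mapping.single (x, y, z) 1
      - Poly_Mapping.single (x, y', z) 1 \<in> null3B"
    and "z' \<in> B \<Longrightarrow> Poly_Mapping.single (x, y, z + z') 1 - Poly_Mapping.single (x, y, z) 1
      - Poly_Mapping.single (x, y, z') 1 \<in> null3B"
    and "Poly_Mapping.single (scale c x, y, z) 1 - Poly_Mapping.single (x, y, z) c \<in> null3B"
    and "Poly_Mapping.single (x, scale c y, z) 1 - Poly_Mapping.single (x, y, z) c \<in> null3B"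
    and "Poly_Mapping.single (x, y, scale c z) 1 - Poly_Mapping.single (x, y, z) c \<in> null3B"
  unfolding null3_def
  \<comment> \<open>Each relation is found by its position in the union of the six families.\<close>
  subgoal by (insert B, rule free.span_base, rule UnI1, rule UnI1, rule UnI1, rule UnI1, rule UnI1, blast)
  subgoal by (insert B, rule free.span_base, rule UnI1, rule UnI1, rule UnI1, rule UnI1, rule UnI2, blast)
  subgoal by (insert B, rule free.span_base, rule UnI1, rule UnI1, rule UnI1, rule UnI2, blast)
  subgoal by (insert B, rule free.span_base, rule UnI1, rule UnI1, rule UnI2, blast)
  subgoal by (insert B, rule free.span_base, rule UnI1, rule UnI2, blast)
  subgoal by (insert B, rule free.span_base, rule UnI2, blast)
  done

lemma tensor_eqD:
  "tensor2 scale B p = tensor2 scale B q \<Longrightarrow> p - q \<in> null2B"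
  "tensor3 scale B p' = tensor3 scale B q' \<Longrightarrow> p' - q' \<in> null3B"
proof -
  assume "tensor2 scale B p = tensor2 scale B q"
  moreover have "p \<in> tensor2 scale B p"
    unfolding tensor2_def using free.subspace_0[OF subspace_null(1)] by force
  ultimately show "p - q \<in> null2B" by (auto simp: tensor2_def)
next
  assume "tensor3 scale B p' = tensor3 scale B q'"
  moreover have "p' \<in> tensor3 scale B p'"
    unfolding tensor3_def using free.subspace_0[OF subspace_null(2)] by force
  ultimately show "p' - q' \<in> null3B" by (auto simp: tensor3_def)
qed

lemma tensor2_eqI:
  assumes "p - q \<in> null2B"
  shows "tensor2 scale B p = tensor2 scale B q"
proof -
  have "(+) p ` null2B = (+) q ` null2B"
  proof (intro equalityI subsetI)
    fix t assume "t \<in> (+) p ` null2B"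
    then obtain n where "n \<in> null2B" "t = p + n" by auto
    then show "t \<in> (+) q ` null2B"
      using free.subspace_add[OF subspace_null(1) assms, of n]
      by (intro image_eqI[of _ _ "(p - q) + n"]) auto
  next
    fix t assume "t \<in> (+) q ` null2B"
    then obtain n where "n \<in> null2B" "t = q + n" by auto
    then show "t \<in> (+) p ` null2B"
      using free.subspace_diff[OF subspace_null(1) _ assms, of n]
      by (intro image_eqI[of _ _ "n - (p - q)"]) auto
  qed
  then show ?thesis by (simp add: tensor2_def)
qed

lemma tensor3_eq_0I:
  assumes "p \<in> null3B"
  shows "tensor3 scale B p = tensor3 scale B 0"
proof -
  have "(+) p ` null3B = null3B"
  proof (intro equalityI subsetI)
    fix q assume "q \<in> null3B"
    then have "q - p \<in> null3B" using assms subspace_null by (auto intro: free.subspace_diff)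
    then show "q \<in> (+) p ` null3B" by (intro image_eqI[of _ _ "q - p"]) auto
  qed (use assms subspace_null in \<open>auto intro: free.subspace_add\<close>)
  then show ?thesis by (simp add: tensor3_def)
qed

text \<open>A product of functionals respects the multilinearity relations, so its linear extension is
  well defined on tensors.\<close>

lemma linear_extension_null2:
  assumes "p \<in> null2B" and f: "functional f" and g: "functional g"
  shows "linear_extension (\<lambda>(x, y). f x * g y) p = 0"
  using assms(1) unfolding null2_def
  by (rule linear_extension_zero_on_span)
    (auto simp: linear_extension_diff linear_onD[OF f] linear_onD[OF g]
      ring_distribs mult_ac)

lemma linear_extension_null3:
  assumes "p \<in> null3B" and f: "functional f" and g: "functional g" and h: "functional h"
  shows "linear_extension (\<lambda>(x, y, z). f x * g y * h z) p = 0"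
  using assms(1) unfolding null3_def
  by (rule linear_extension_zero_on_span)
    (auto simp: linear_extension_diff linear_onD[OF f] linear_onD[OF g] linear_onD[OF h]
      ring_distribs mult_ac)

text \<open>Products of functionals separate tensors. A finite frame \<open>e\<close> of \<open>B\<close> with coordinate functionals
  \<open>e'\<close> expands every pure tensor, modulo the multilinearity relations, in the tensors
  \<open>e i \<otimes> e j \<otimes> e k\<close>; the coefficients are the values of \<open>e' i \<otimes> e' j \<otimes> e' k\<close>.\<close>

lemma null3I:
  assumes "finite I" and eB: "\<And>i. i \<in> I \<Longrightarrow> e i \<in> B"
    and frame: "\<And>x. x \<in> B \<Longrightarrow> x = (\<Sum>i\<in>I. scale (e' i x) (e i))"
    and p: "Poly_Mapping.keys p \<subseteq> B \<times> B \<times> B"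
    and zero: "\<And>i j k. \<lbrakk>i \<in> I; j \<in> I; k \<in> I\<rbrakk> \<Longrightarrow>
      linear_extension (\<lambda>(x, y, z). e' i x * e' j y * e' k z) p = 0"
  shows "p \<in> null3B"
proof -
  note N = subspace_null(2)
  let ?s = "\<lambda>x y z. Poly_Mapping.single (x, y, z) 1 :: ('b \<times> 'b \<times> 'b) \<Rightarrow>\<^sub>0 'k"
  have expand1: "?s x y z - (\<Sum>i\<in>I. free_scale (e' i x) (?s (e i) y z)) \<in> null3B"
    if "x \<in> B" "y \<in> B" "z \<in> B" for x y z
  proof -
    have "?s (\<Sum>i\<in>I. scale (e' i x) (e i)) y z
        - (\<Sum>i\<in>I. free_scale (e' i x) (?s (e i) y z)) \<in> null3B"
      by (rule linear_modulo_sum[where \<phi> = "\<lambda>w. ?s w y z",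
            OF vector_space_axioms subspace_B N _ _ \<open>finite I\<close> eB])
        (use that in \<open>auto intro: null3_relations\<close>)
    then show ?thesis using frame[OF that(1)] by simp
  qed
  have expand2: "?s x y z - (\<Sum>i\<in>I. free_scale (e' i y) (?s x (e i) z)) \<in> null3B"
    if "x \<in> B" "y \<in> B" "z \<in> B" for x y z
  proof -
    have "?s x (\<Sum>i\<in>I. scale (e' i y) (e i)) z
        - (\<Sum>i\<in>I. free_scale (e' i y) (?s x (e i) z)) \<in> null3B"
      by (rule linear_modulo_sum[where \<phi> = "\<lambda>w. ?s x w z",
            OF vector_space_axioms subspace_B N _ _ \<open>finite I\<close> eB])
        (use that in \<open>auto intro: null3_relations\<close>)
    then show ?thesis using frame[OF that(2)] by simp
  qed
  have expand3: "?s x y z - (\<Sum>i\<in>I. free_scale (e' i z) (?s x y (e i))) \<in> null3B"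
    if "x \<in> B" "y \<in> B" "z \<in> B" for x y z
  proof -
    have "?s x y (\<Sum>i\<in>I. scale (e' i z) (e i))
        - (\<Sum>i\<in>I. free_scale (e' i z) (?s x y (e i))) \<in> null3B"
      by (rule linear_modulo_sum[where \<phi> = "\<lambda>w. ?s x y w",
            OF vector_space_axioms subspace_B N _ _ \<open>finite I\<close> eB])
        (use that in \<open>auto intro: null3_relations\<close>)
    then show ?thesis using frame[OF that(3)] by simp
  qed
  \<comment> \<open>\<open>E x y z\<close> is the full expansion of a pure tensor; it is reached by expanding one slot at a time.\<close>
  define E where "E x y z = (\<Sum>i\<in>I. \<Sum>j\<in>I. \<Sum>k\<in>I.
    free_scale (e' i x * e' j y * e' k z) (?s (e i) (e j) (e k)))" for x y z
  have expand: "?s x y z - E x y z \<in> null3B" if "x \<in> B" "y \<in> B" "z \<in> B" for x y z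
  proof -
    have "(?s x y z - (\<Sum>i\<in>I. free_scale (e' i x) (?s (e i) y z)))
       + (\<Sum>i\<in>I. free_scale (e' i x)
            (?s (e i) y z - (\<Sum>j\<in>I. free_scale (e' j y) (?s (e i) (e j) z))))
       + (\<Sum>i\<in>I. \<Sum>j\<in>I. free_scale (e' i x * e' j y)
            (?s (e i) (e j) z - (\<Sum>k\<in>I. free_scale (e' k z) (?s (e i) (e j) (e k))))) \<in> null3B"
      using that eB
      by (intro free.subspace_add[OF N] free.subspace_sum[OF N] free.subspace_scale[OF N]
          expand1 expand2 expand3) auto
    moreover have "(?s x y z - (\<Sum>i\<in>I. free_scale (e' i x) (?s (e i) y z)))
       + (\<Sum>i\<in>I. free_scale (e' i x)
            (?s (e i) y z - (\<Sum>j\<in>I. free_scale (e' j y) (?s (e i) (e j) z))))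
       + (\<Sum>i\<in>I. \<Sum>j\<in>I. free_scale (e' i x * e' j y)
            (?s (e i) (e j) z - (\<Sum>k\<in>I. free_scale (e' k z) (?s (e i) (e j) (e k)))))
      = ?s x y z - E x y z"
      by (simp only: E_def free.scale_right_diff_distrib free.scale_sum_right sum_subtractf
          free.scale_scale diff_add_cancel add_diff_eq mult.assoc)
    ultimately show ?thesis by (simp only:)
  qed
  have "(\<Sum>t\<in>Poly_Mapping.keys p. free_scale (Poly_Mapping.lookup p t)
      (case t of (x, y, z) \<Rightarrow> ?s x y z - E x y z)) \<in> null3B"
    using p expand by (intro free.subspace_sum[OF N] free.subspace_scale[OF N]) auto
  moreover have "(\<Sum>t\<in>Poly_Mapping.keys p. free_scale (Poly_Mapping.lookup p t)
      (case t of (x, y, z) \<Rightarrow> E x y z)) = 0"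
  proof -
    have "(\<Sum>t\<in>Poly_Mapping.keys p. free_scale (Poly_Mapping.lookup p t)
        (case t of (x, y, z) \<Rightarrow> E x y z))
      = (\<Sum>t\<in>Poly_Mapping.keys p. \<Sum>i\<in>I. \<Sum>j\<in>I. \<Sum>k\<in>I.
          free_scale (Poly_Mapping.lookup p t * (case t of (x, y, z) \<Rightarrow> e' i x * e' j y * e' k z))
            (?s (e i) (e j) (e k)))"
      by (intro sum.cong refl)
        (simp only: E_def free.scale_sum_right free.scale_scale split_def)
    also have "\<dots> = (\<Sum>i\<in>I. \<Sum>j\<in>I. \<Sum>k\<in>I. \<Sum>t\<in>Poly_Mapping.keys p.
          free_scale (Poly_Mapping.lookup p t * (case t of (x, y, z) \<Rightarrow> e' i x * e' j y * e' k z))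
            (?s (e i) (e j) (e k)))"
      by (subst sum.swap, intro sum.cong refl, subst sum.swap, intro sum.cong refl,
          subst sum.swap, intro sum.cong refl)
    also have "\<dots> = (\<Sum>i\<in>I. \<Sum>j\<in>I. \<Sum>k\<in>I. free_scale
          (linear_extension (\<lambda>(x, y, z). e' i x * e' j y * e' k z) p) (?s (e i) (e j) (e k)))"
      by (simp only: linear_extension_def free.scale_sum_left)
    also have "\<dots> = 0" by (simp add: zero)
    finally show ?thesis .
  qed
  ultimately show ?thesis
    by (subst sum_of_terms[of p])
      (simp add: split_def free.scale_right_diff_distrib sum_subtractf del: free_scale_single)
qed

lemma tensor_diff_tensor2:
  "tensor_diff (tensor2 scale B p) (tensor2 scale B q) = tensor2 scale B (p - q)"
proof (intro equalityI subsetI)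
  fix t assume "t \<in> tensor_diff (tensor2 scale B p) (tensor2 scale B q)"
  then obtain m n where "m \<in> null2B" "n \<in> null2B" "t = (p + m) - (q + n)"
    by (auto simp: tensor_diff_def tensor2_def)
  then show "t \<in> tensor2 scale B (p - q)"
    unfolding tensor2_def using free.subspace_diff[OF subspace_null(1), of m n]
    by (intro image_eqI[of _ _ "m - n"]) auto
next
  fix t assume "t \<in> tensor2 scale B (p - q)"
  then obtain m where "m \<in> null2B" "t = (p + m) - (q + 0)"
    by (auto simp: tensor2_def)
  then show "t \<in> tensor_diff (tensor2 scale B p) (tensor2 scale B q)"
    unfolding tensor_diff_def tensor2_def using free.subspace_0[OF subspace_null(1)] by blast
qed

text \<open>The flip exchanges the relations for the left slot with those for the right slot, so it
  descends to cosets.\<close>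

lemma map_key_swap_null2:
  assumes "p \<in> null2B"
  shows "Poly_Mapping.map_key prod.swap p \<in> null2B"
proof -
  let ?flip = "Poly_Mapping.map_key prod.swap :: (('b \<times> 'b) \<Rightarrow>\<^sub>0 'k) \<Rightarrow> _"
  have inj: "inj (prod.swap :: 'b \<times> 'b \<Rightarrow> _)" by simp
  have single: "?flip (Poly_Mapping.single (x, y) c) = Poly_Mapping.single (y, x) c" for x y c
    using map_key_single[OF inj, of "(y, x)" c] by simp
  have add: "?flip (p + q) = ?flip p + ?flip q" for p q by (rule map_key_plus[OF inj])
  have diff: "?flip (p - q) = ?flip p - ?flip q" for p q
    by (metis add add_diff_cancel diff_add_cancel)
  have scl: "?flip (free_scale c p) = free_scale c (?flip p)" for c p
    by (rule poly_mapping_eqI) (simp add: map_key.rep_eq[OF inj])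
  show ?thesis
    using assms unfolding null2_def
  proof (induction rule: free.span_induct_alt)
    case base
    show ?case by (simp add: free.span_zero)
  next
    case (step c p q)
    from step(1) have "?flip p \<in> null2B"
      unfolding null2_def Un_iff mem_Collect_eq
      apply -
      apply (elim disjE exE conjE; hypsubst; simp only: diff single; rule free.span_base)
      \<comment> \<open>The images lie in the other additivity family and the other homogeneity family.\<close>
      subgoal by (rule UnI1, rule UnI1, rule UnI2) blast
      subgoal by (rule UnI1, rule UnI1, rule UnI1) blast
      subgoal by (rule UnI2) blast
      subgoal by (rule UnI1, rule UnI2) blast
      done
    then show ?case
      using step(2) by (simp add: add scl null2_def free.span_add free.span_scale)
  qed
qed

lemma tensor_flip_tensor2:
  "tensor_flip (tensor2 scale B p) = tensor2 scale B (Poly_Mapping.map_key prod.swap p)"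
proof -
  let ?flip = "Poly_Mapping.map_key prod.swap :: (('b \<times> 'b) \<Rightarrow>\<^sub>0 'k) \<Rightarrow> _"
  have inj: "inj (prod.swap :: 'b \<times> 'b \<Rightarrow> _)" by simp
  have invol: "?flip (?flip n) = n" for n
    by (rule poly_mapping_eqI) (simp add: map_key.rep_eq[OF inj])
  have "?flip ` null2B = null2B"
  proof (intro equalityI subsetI)
    fix n assume "n \<in> null2B"
    then show "n \<in> ?flip ` null2B"
      by (intro image_eqI[of _ _ "?flip n"] map_key_swap_null2) (simp_all only: invol)
  qed (use map_key_swap_null2 in blast)
  then have "(+) (?flip p) ` null2B = (\<lambda>n. ?flip p + ?flip n) ` null2B"
    by (metis image_image)
  then show ?thesis
    by (simp only: tensor_flip_def tensor2_def image_image map_key_plus[OF inj])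
qed

end


section \<open>The Yang-Baxter equation in terms of contractions\<close>

definition N_sum :: "('b \<Rightarrow> 'b \<Rightarrow> 'b) \<Rightarrow> ('b::ab_group_add \<times> 'b) list \<Rightarrow> (('b \<times> 'b \<times> 'b) \<Rightarrow>\<^sub>0 'k::field)"
  where "N_sum circ ps = (\<Sum>(x, y)\<leftarrow>ps. \<Sum>(x', y')\<leftarrow>ps.
        Poly_Mapping.single (x, x', circ y y') 1
      + Poly_Mapping.single (x, circ y x' + circ x' y, y') 1
      + Poly_Mapping.single (circ x x', y', y) 1)"

definition C_sum :: "('b \<Rightarrow> 'b \<Rightarrow> 'b) \<Rightarrow> ('b::ab_group_add \<times> 'b) list \<Rightarrow> (('b \<times> 'b \<times> 'b) \<Rightarrow>\<^sub>0 'k::field)"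
  where "C_sum br ps = (\<Sum>(x, y)\<leftarrow>ps. \<Sum>(x', y')\<leftarrow>ps.
        Poly_Mapping.single (br x x', y, y') 1
      + Poly_Mapping.single (x, br y x', y') 1
      + Poly_Mapping.single (x, x', br y y') 1)"

lemma N_tensor_eq: "N_tensor scale B circ ps = tensor3 scale B (N_sum circ ps)"
  by (simp add: N_tensor_def N_sum_def)

lemma C_tensor_eq: "C_tensor scale B br ps = tensor3 scale B (C_sum br ps)"
  by (simp add: C_tensor_def C_sum_def)

context tensor_factor
begin

text \<open>A tensor \<open>r\<close> is seen as the pair of linear maps \<open>f \<mapsto> (f \<otimes> id) r\<close> and \<open>f \<mapsto> (id \<otimes> f) r\<close> from
  functionals to vectors.\<close>

definition contract_left :: "('b \<Rightarrow> 'k) \<Rightarrow> ('b \<times> 'b) list \<Rightarrow> 'b"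
  where "contract_left f ps = (\<Sum>(x, y)\<leftarrow>ps. scale (f x) y)"

definition contract_right :: "('b \<Rightarrow> 'k) \<Rightarrow> ('b \<times> 'b) list \<Rightarrow> 'b"
  where "contract_right f ps = (\<Sum>(x, y)\<leftarrow>ps. scale (f y) x)"

lemma linear_on_sum_list:
  assumes f: "functional f" and "e ` set is \<subseteq> B"
  shows "(\<Sum>i\<leftarrow>is. scale (c i) (e i)) \<in> B"
    and "f (\<Sum>i\<leftarrow>is. scale (c i) (e i)) = (\<Sum>i\<leftarrow>is. c i * f (e i))"
proof -
  have "(\<Sum>i\<leftarrow>is. scale (c i) (e i)) \<in> B \<and>
    f (\<Sum>i\<leftarrow>is. scale (c i) (e i)) = (\<Sum>i\<leftarrow>is. c i * f (e i))"
    using assms(2)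
  proof (induction "is")
    case Nil
    then show ?case
      using subspace_B linear_onD(3)[OF f, of 0 0] by (simp add: subspace_def)
  next
    case (Cons i "is")
    then have "scale (c i) (e i) \<in> B" using subspace_B by (simp add: subspace_def)
    with Cons show ?case
      using subspace_B by (simp add: subspace_def linear_onD[OF f])
  qed
  then show "(\<Sum>i\<leftarrow>is. scale (c i) (e i)) \<in> B"
    and "f (\<Sum>i\<leftarrow>is. scale (c i) (e i)) = (\<Sum>i\<leftarrow>is. c i * f (e i))" by auto
qed

lemma bilinear_sum_list:
  assumes \<Phi>: "bilinear_on scale scale (*) B B UNIV \<Phi>"
    and e: "e ` set is \<subseteq> B" "e' ` set js \<subseteq> B"
  shows "\<Phi> (\<Sum>i\<leftarrow>is. scale (c i) (e i)) (\<Sum>j\<leftarrow>js. scale (d j) (e' j))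
    = (\<Sum>i\<leftarrow>is. \<Sum>j\<leftarrow>js. c i * d j * \<Phi> (e i) (e' j))"
proof -
  let ?y = "\<Sum>j\<leftarrow>js. scale (d j) (e' j)"
  have y: "?y \<in> B"
    using linear_on_sum_list(1)[of "\<lambda>_. 0" e' js d] e by (simp add: linear_on_def)
  have "\<Phi> (\<Sum>i\<leftarrow>is. scale (c i) (e i)) ?y = (\<Sum>i\<leftarrow>is. c i * \<Phi> (e i) ?y)"
    by (rule linear_on_sum_list(2)[OF bilinear_onD(2)[OF \<Phi> y] e(1)])
  also have "\<dots> = (\<Sum>i\<leftarrow>is. c i * (\<Sum>j\<leftarrow>js. d j * \<Phi> (e i) (e' j)))"
    using e(1)
    by (intro arg_cong[of _ _ sum_list] map_cong refl arg_cong2[of _ _ _ _ "(*)"]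
        linear_on_sum_list(2)[OF bilinear_onD(1)[OF \<Phi>] e(2)]) auto
  finally show ?thesis by (simp add: sum_list_const_mult mult.assoc)
qed

lemma functional_contract:
  assumes f: "functional f" and g: "functional g" and ps: "set ps \<subseteq> B \<times> B"
  shows "g (contract_left f ps)
      = linear_extension (\<lambda>(x, y). f x * g y) (\<Sum>(x, y)\<leftarrow>ps. Poly_Mapping.single (x, y) 1)"
    and "f (contract_right g ps)
      = linear_extension (\<lambda>(x, y). f x * g y) (\<Sum>(x, y)\<leftarrow>ps. Poly_Mapping.single (x, y) 1)"
  using linear_on_sum_list(2)[OF g, of snd ps "\<lambda>p. f (fst p)"]
    linear_on_sum_list(2)[OF f, of fst ps "\<lambda>p. g (snd p)"] ps
  by (force simp: contract_left_def contract_right_def split_def linear_extension_sum_list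
      mult.commute)+

lemma contract_in_B:
  assumes "set ps \<subseteq> B \<times> B"
  shows "contract_left f ps \<in> B" and "contract_right f ps \<in> B"
proof -
  have "functional (\<lambda>_. 0)" by (simp add: linear_on_def)
  from linear_on_sum_list(1)[OF this, of snd ps "\<lambda>p. f (fst p)"]
    linear_on_sum_list(1)[OF this, of fst ps "\<lambda>p. f (snd p)"] assms
  show "contract_left f ps \<in> B" and "contract_right f ps \<in> B"
    by (force simp: contract_left_def contract_right_def split_def)+
qed

lemma functional_of_product:
  assumes op: "bilinear_on scale scale scale B B B op" and h: "functional h"
  shows "bilinear_on scale scale (*) B B UNIV (\<lambda>x y. h (op x y))"
  using op h by (simp add: bilinear_on_def linear_on_def)

text \<open>In each of the three terms the two functionals that meet a bare leg of \<open>r\<close> become scalars, which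
  contract the two copies of \<open>r\<close>; by bilinearity the sums then move inside the operation.\<close>

lemma linear_extension_N_sum:
  assumes op: "bilinear_on scale scale scale B B B op" and ps: "set ps \<subseteq> B \<times> B"
    and f: "functional f" and g: "functional g" and h: "functional h"
  shows "linear_extension (\<lambda>(x, y, z). f x * g y * h z) (N_sum op ps)
    = h (op (contract_left f ps) (contract_left g ps))
    + g (op (contract_left f ps) (contract_right h ps) + op (contract_right h ps) (contract_left f ps))
    + f (op (contract_right h ps) (contract_right g ps))"
proof -
  have star: "bilinear_on scale scale scale B B B (\<lambda>x y. op x y + op y x)"
    using op subspace_B
    by (simp add: bilinear_on_def linear_on_def subspace_def scale_right_distrib)
  have im: "fst ` set ps \<subseteq> B" "snd ` set ps \<subseteq> B" using ps by auto
  note * = bilinear_sum_list[OF functional_of_product]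
  show ?thesis
    unfolding contract_left_def contract_right_def split_def
      *[OF op h im(2,2)] *[OF star g im(2,1)] *[OF op f im(1,1)]
    by (simp add: N_sum_def split_def linear_extension_sum_list linear_extension_add
        sum_list_addf mult_ac)
qed

lemma linear_extension_C_sum:
  assumes op: "bilinear_on scale scale scale B B B op" and ps: "set ps \<subseteq> B \<times> B"
    and f: "functional f" and g: "functional g" and h: "functional h"
  shows "linear_extension (\<lambda>(x, y, z). f x * g y * h z) (C_sum op ps)
    = f (op (contract_right g ps) (contract_right h ps))
    + g (op (contract_left f ps) (contract_right h ps))
    + h (op (contract_left f ps) (contract_left g ps))"
proof -
  have im: "fst ` set ps \<subseteq> B" "snd ` set ps \<subseteq> B" using ps by auto
  note * = bilinear_sum_list[OF functional_of_product]
  show ?thesis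
    unfolding contract_left_def contract_right_def split_def
      *[OF op h im(2,2)] *[OF op g im(2,1)] *[OF op f im(1,1)]
    by (simp add: C_sum_def split_def linear_extension_sum_list linear_extension_add
        sum_list_addf mult_ac)
qed

lemma keys_N_sum_C_sum:
  assumes op: "bilinear_on scale scale scale B B B op" and ps: "set ps \<subseteq> B \<times> B"
  shows "Poly_Mapping.keys (N_sum op ps) \<subseteq> B \<times> B \<times> B"
    and "Poly_Mapping.keys (C_sum op ps) \<subseteq> B \<times> B \<times> B"
proof -
  have op_in: "op x y \<in> B" if "x \<in> B" "y \<in> B" for x y
    using linear_onD(1)[OF bilinear_onD(1)[OF op]] that by blast
  have add: "x + y \<in> B" if "x \<in> B" "y \<in> B" for x y
    using subspace_B that by (simp add: subspace_def)
  have ps_in: "fst t \<in> B" "snd t \<in> B" if "t \<in> set ps" for t using that ps by auto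
  show "Poly_Mapping.keys (N_sum op ps) \<subseteq> B \<times> B \<times> B"
    unfolding N_sum_def split_def
    by (intro keys_sum_list subset_trans[OF keys_add] Un_least)
      (auto intro!: op_in add ps_in)
  show "Poly_Mapping.keys (C_sum op ps) \<subseteq> B \<times> B \<times> B"
    unfolding C_sum_def split_def
    by (intro keys_sum_list subset_trans[OF keys_add] Un_least)
      (auto intro!: op_in ps_in)
qed

end

text \<open>The functionals in \<open>Fs\<close> detect whether a tensor vanishes because they include the coordinates
  of a finite frame. A larger set than the coordinates is allowed so that a more convenient family
  of functionals can be used in the evaluation.\<close>

locale framed_tensor_factor = tensor_factor scale B
  for scale :: "'k::field \<Rightarrow> 'b::ab_group_add \<Rightarrow> 'b" and B +
  fixes I :: "'i set" and e :: "'i \<Rightarrow> 'b" and e' :: "'i \<Rightarrow> 'b \<Rightarrow> 'k" and Fs :: "('b \<Rightarrow> 'k) set"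
  assumes finite_I: "finite I"
    and frame_in_B: "i \<in> I \<Longrightarrow> e i \<in> B"
    and frame_expansion: "x \<in> B \<Longrightarrow> x = (\<Sum>i\<in>I. scale (e' i x) (e i))"
    and coordinate_in_Fs: "i \<in> I \<Longrightarrow> e' i \<in> Fs"
    and functional_Fs: "f \<in> Fs \<Longrightarrow> functional f"
begin

lemma functionals_separate:
  assumes "x \<in> B" "y \<in> B" "\<And>f. f \<in> Fs \<Longrightarrow> f x = f y"
  shows "x = y"
proof -
  have "(\<Sum>i\<in>I. scale (e' i x) (e i)) = (\<Sum>i\<in>I. scale (e' i y) (e i))"
    by (intro sum.cong refl) (simp add: assms(3) coordinate_in_Fs)
  then show ?thesis
    using frame_expansion[OF assms(1)] frame_expansion[OF assms(2)] by (simp only:)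
qed

lemma tensor3_eq_0_iff:
  assumes "Poly_Mapping.keys p \<subseteq> B \<times> B \<times> B"
  shows "tensor3 scale B p = tensor3 scale B 0 \<longleftrightarrow>
    (\<forall>f\<in>Fs. \<forall>g\<in>Fs. \<forall>h\<in>Fs. linear_extension (\<lambda>(x, y, z). f x * g y * h z) p = 0)"
proof
  assume "tensor3 scale B p = tensor3 scale B 0"
  then have "p \<in> null3B" using tensor_eqD(2)[of p 0] by simp
  then show "\<forall>f\<in>Fs. \<forall>g\<in>Fs. \<forall>h\<in>Fs. linear_extension (\<lambda>(x, y, z). f x * g y * h z) p = 0"
    using linear_extension_null3 functional_Fs by blast
next
  assume "\<forall>f\<in>Fs. \<forall>g\<in>Fs. \<forall>h\<in>Fs. linear_extension (\<lambda>(x, y, z). f x * g y * h z) p = 0"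
  then have "p \<in> null3B"
    by (intro null3I[OF finite_I frame_in_B frame_expansion assms]) (auto intro: coordinate_in_Fs)
  then show "tensor3 scale B p = tensor3 scale B 0" by (rule tensor3_eq_0I)
qed

text \<open>The values \<open>(f \<otimes> g) r\<close> depend only on the coset \<open>r\<close>, and a vector is determined by its values
  under functionals.\<close>

lemma contract_depends_on_tensor:
  assumes ps: "set ps \<subseteq> B \<times> B" and qs: "set qs \<subseteq> B \<times> B"
    and eq: "sum_tensor scale B ps = sum_tensor scale B qs" and f: "f \<in> Fs"
  shows "contract_left f ps = contract_left f qs" and "contract_right f ps = contract_right f qs"
proof -
  have null: "(\<Sum>(x, y)\<leftarrow>ps. Poly_Mapping.single (x, y) 1)
      - (\<Sum>(x, y)\<leftarrow>qs. Poly_Mapping.single (x, y) 1) \<in> null2B"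
    using eq unfolding sum_tensor_def by (rule tensor_eqD(1))
  have same: "linear_extension (\<lambda>(x, y). g x * h y) (\<Sum>(x, y)\<leftarrow>ps. Poly_Mapping.single (x, y) 1)
      = linear_extension (\<lambda>(x, y). g x * h y) (\<Sum>(x, y)\<leftarrow>qs. Poly_Mapping.single (x, y) 1)"
    if "g \<in> Fs" "h \<in> Fs" for g h
    using linear_extension_null2[OF null functional_Fs functional_Fs] that
    by (simp add: linear_extension_diff)
  show "contract_left f ps = contract_left f qs"
    by (rule functionals_separate)
      (simp_all add: contract_in_B ps qs functional_contract(1) functional_Fs f same)
  show "contract_right f ps = contract_right f qs"
    by (rule functionals_separate)
      (simp_all add: contract_in_B ps qs functional_contract(2) functional_Fs f same)
qed

text \<open>The equation quantifies over all expressions for the tensor, but its values at functionals are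
  functions of the contractions alone. One expression therefore decides it.\<close>

theorem gdybe_solution_iff:
  assumes circ: "bilinear_on scale scale scale B B B circ"
    and br: "bilinear_on scale scale scale B B B br" and ps: "set ps \<subseteq> B \<times> B"
  shows "gdybe_solution scale B circ br (sum_tensor scale B ps) \<longleftrightarrow>
    (\<forall>f\<in>Fs. \<forall>g\<in>Fs. \<forall>h\<in>Fs.
      h (circ (contract_left f ps) (contract_left g ps))
      + g (circ (contract_left f ps) (contract_right h ps)
          + circ (contract_right h ps) (contract_left f ps))
      + f (circ (contract_right h ps) (contract_right g ps)) = 0 \<and>
      f (br (contract_right g ps) (contract_right h ps))
      + g (br (contract_left f ps) (contract_right h ps))
      + h (br (contract_left f ps) (contract_left g ps)) = 0)"
    (is "_ \<longleftrightarrow> ?R ps")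
proof -
  have *: "N_tensor scale B circ qs = tensor3 scale B 0 \<and> C_tensor scale B br qs = tensor3 scale B 0
      \<longleftrightarrow> ?R qs" if qs: "set qs \<subseteq> B \<times> B" for qs
    using circ br qs
    by (simp add: N_tensor_eq C_tensor_eq tensor3_eq_0_iff keys_N_sum_C_sum linear_extension_N_sum
        linear_extension_C_sum functional_Fs ball_conj_distrib)
  have same: "?R qs \<longleftrightarrow> ?R ps"
    if "set qs \<subseteq> B \<times> B" "sum_tensor scale B qs = sum_tensor scale B ps" for qs
    using contract_depends_on_tensor[OF that(1) ps that(2)] by simp
  have mem: "sum_tensor scale B ps \<in> tensor_space2 scale B"
    unfolding sum_tensor_def tensor_space2_def free_space_def using ps
    by (intro imageI CollectI keys_sum_list) auto
  show ?thesis
  proof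
    assume "gdybe_solution scale B circ br (sum_tensor scale B ps)"
    then have "N_tensor scale B circ ps = tensor3 scale B 0 \<and> C_tensor scale B br ps = tensor3 scale B 0"
      using ps unfolding gdybe_solution_def by blast
    then show "?R ps" by (simp only: *[OF ps])
  next
    assume R: "?R ps"
    show "gdybe_solution scale B circ br (sum_tensor scale B ps)"
      unfolding gdybe_solution_def
    proof (intro conjI[OF mem] allI impI)
      fix qs assume qs: "set qs \<subseteq> B \<times> B \<and> sum_tensor scale B qs = sum_tensor scale B ps"
      with R have "?R qs" using same[of qs] by (simp only:)
      then show "N_tensor scale B circ qs = tensor3 scale B 0
          \<and> C_tensor scale B br qs = tensor3 scale B 0"
        using qs by (simp only: *)
    qed
  qed
qed

end


section \<open>The semi-direct product with the dual representation\<close>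

text \<open>Functionals on \<open>A \<oplus> V\<^sup>*\<close> are pairs from \<open>A\<^sup>* \<times> V\<close>, a vector of \<open>V\<close> acting on \<open>V\<^sup>*\<close> by
  evaluation.\<close>

definition pair_functional :: "('a \<Rightarrow> 'k) \<Rightarrow> 'v \<Rightarrow> 'a \<times> ('v \<Rightarrow> 'k::field) \<Rightarrow> 'k"
  where "pair_functional \<alpha> u x = \<alpha> (fst x) + snd x u"

lemma linear_iff_linear_on:
  assumes "vector_space s1" "vector_space s2"
  shows "Vector_Spaces.linear s1 s2 f \<longleftrightarrow> linear_on s1 s2 UNIV UNIV f"
  using assms by (simp add: Vector_Spaces.linear_iff linear_on_def)

lemmas linear_simps = module_hom.add[OF module_hom_linearI] module_hom.diff[OF module_hom_linearI]
  module_hom.neg[OF module_hom_linearI] module_hom.zero[OF module_hom_linearI]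
  module_hom.scale[OF module_hom_linearI]

lemma sum_apply: "(\<Sum>i\<in>S. g i) u = (\<Sum>i\<in>S. g i u)"
  by (induction S rule: infinite_finite_induct) auto

lemma dual_scale_zero: "dual_scale c 0 = 0"
  by (simp add: dual_scale_def fun_eq_iff)

lemma vector_space_field: "vector_space ((*) :: 'k::field \<Rightarrow> 'k \<Rightarrow> 'k)"
  by unfold_locales (auto simp: algebra_simps)

locale linear_map_into_gd_algebra =
  finA: finite_dimensional_vector_space scaleA BasisA +
  finV: finite_dimensional_vector_space scaleV BasisV +
  rep: gd_representation scaleA UNIV circ br scaleV UNIV l r \<rho> +
  T: Vector_Spaces.linear scaleV scaleA T
  for scaleA :: "'k::field \<Rightarrow> 'a::ab_group_add \<Rightarrow> 'a" and BasisA
    and scaleV :: "'k \<Rightarrow> 'v::ab_group_add \<Rightarrow> 'v" and BasisV circ br l r \<rho> T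
begin

abbreviation "scale_hat \<equiv> sd_scale scaleA dual_scale"
abbreviation "carrier_hat \<equiv> UNIV \<times> dual_space scaleV"
abbreviation "circ_hat \<equiv> sd_circ circ (dual_map l + dual_map r) (- dual_map r)"
abbreviation "br_hat \<equiv> sd_br br (dual_map \<rho>)"
abbreviation "coord \<equiv> dual_basis scaleV BasisV"
abbreviation "coordA a x \<equiv> finA.representation BasisA x a"

definition "functionals = {pair_functional \<alpha> u | \<alpha> u. Vector_Spaces.linear scaleA (*) \<alpha>}"

lemma ball_functionals:
  "(\<forall>f\<in>functionals. P f) \<longleftrightarrow>
    (\<forall>\<alpha> u. Vector_Spaces.linear scaleA (*) \<alpha> \<longrightarrow> P (pair_functional \<alpha> u))"
  by (auto simp: functionals_def)

lemma dual_iff: "f \<in> dual_space scaleV \<longleftrightarrow> Vector_Spaces.linear scaleV (*) f"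
  by (simp add: dual_space_def)

lemma dual_simps:
  assumes "f \<in> dual_space scaleV"
  shows "f (u + v) = f u + f v" "f (u - v) = f u - f v" "f (- u) = - f u" "f 0 = 0"
    "f (scaleV c u) = c * f u"
  using assms by (simp_all add: dual_iff linear_simps)

lemma dualI:
  assumes "\<And>u v. f (u + v) = f u + f v" "\<And>c u. f (scaleV c u) = c * f u"
  shows "f \<in> dual_space scaleV"
  using assms finV.vector_space_axioms vector_space_field
  by (simp add: dual_iff Vector_Spaces.linear_iff)

lemma dual_closed:
  "0 \<in> dual_space scaleV"
  "f \<in> dual_space scaleV \<Longrightarrow> g \<in> dual_space scaleV \<Longrightarrow> f + g \<in> dual_space scaleV"
  "f \<in> dual_space scaleV \<Longrightarrow> g \<in> dual_space scaleV \<Longrightarrow> f - g \<in> dual_space scaleV"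
  "f \<in> dual_space scaleV \<Longrightarrow> - f \<in> dual_space scaleV"
  "f \<in> dual_space scaleV \<Longrightarrow> dual_scale c f \<in> dual_space scaleV"
  by (auto intro!: dualI simp: dual_simps dual_scale_def algebra_simps)

lemma action_simps:
  "l (a + b) u = l a u + l b u" "l (scaleA c a) u = scaleV c (l a u)" "l (- a) u = - l a u"
  "l a (u + v) = l a u + l a v" "l a (scaleV c u) = scaleV c (l a u)"
  "r (a + b) u = r a u + r b u" "r (scaleA c a) u = scaleV c (r a u)" "r (- a) u = - r a u"
  "r a (u + v) = r a u + r a v" "r a (scaleV c u) = scaleV c (r a u)"
  "\<rho> (a + b) u = \<rho> a u + \<rho> b u" "\<rho> (scaleA c a) u = scaleV c (\<rho> a u)" "\<rho> (- a) u = - \<rho> a u"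
  "\<rho> a (u + v) = \<rho> a u + \<rho> a v" "\<rho> a (scaleV c u) = scaleV c (\<rho> a u)"
proof -
  have "Vector_Spaces.linear scaleA scaleV (\<lambda>a. l a u)" "Vector_Spaces.linear scaleV scaleV (l a)"
    "Vector_Spaces.linear scaleA scaleV (\<lambda>a. r a u)" "Vector_Spaces.linear scaleV scaleV (r a)"
    "Vector_Spaces.linear scaleA scaleV (\<lambda>a. \<rho> a u)" "Vector_Spaces.linear scaleV scaleV (\<rho> a)"
    for a u
    using rep.bilinear_l rep.bilinear_r rep.bilinear_rho
    by (simp_all add: bilinear_on_def
        linear_iff_linear_on[OF finA.vector_space_axioms finV.vector_space_axioms]
        linear_iff_linear_on[OF finV.vector_space_axioms finV.vector_space_axioms])
  note * = this[THEN module_hom_linearI]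
  show
    "l (a + b) u = l a u + l b u" "l (scaleA c a) u = scaleV c (l a u)" "l (- a) u = - l a u"
    "l a (u + v) = l a u + l a v" "l a (scaleV c u) = scaleV c (l a u)"
    "r (a + b) u = r a u + r b u" "r (scaleA c a) u = scaleV c (r a u)" "r (- a) u = - r a u"
    "r a (u + v) = r a u + r a v" "r a (scaleV c u) = scaleV c (r a u)"
    "\<rho> (a + b) u = \<rho> a u + \<rho> b u" "\<rho> (scaleA c a) u = scaleV c (\<rho> a u)" "\<rho> (- a) u = - \<rho> a u"
    "\<rho> a (u + v) = \<rho> a u + \<rho> a v" "\<rho> a (scaleV c u) = scaleV c (\<rho> a u)"
    by (fact *[THEN module_hom.add] *[THEN module_hom.scale] *[THEN module_hom.neg])+
qed

lemma product_simps:
  "circ (a + b) c = circ a c + circ b c" "circ (scaleA k a) c = scaleA k (circ a c)"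
  "circ (- a) c = - circ a c"
  "circ a (b + c) = circ a b + circ a c" "circ a (scaleA k c) = scaleA k (circ a c)"
  "circ a (- c) = - circ a c"
  "br (a + b) c = br a c + br b c" "br (scaleA k a) c = scaleA k (br a c)"
  "br (- a) c = - br a c"
  "br a (b + c) = br a b + br a c" "br a (scaleA k c) = scaleA k (br a c)"
  "br a (- c) = - br a c"
proof -
  have "Vector_Spaces.linear scaleA scaleA (\<lambda>a. circ a c)" "Vector_Spaces.linear scaleA scaleA (circ a)"
    "Vector_Spaces.linear scaleA scaleA (\<lambda>a. br a c)" "Vector_Spaces.linear scaleA scaleA (br a)"
    for a c
    using rep.bilinear_circ rep.bilinear_br
    by (simp_all add: bilinear_on_def
        linear_iff_linear_on[OF finA.vector_space_axioms finA.vector_space_axioms])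
  note * = this[THEN module_hom_linearI]
  show "circ (a + b) c = circ a c + circ b c" "circ (scaleA k a) c = scaleA k (circ a c)"
    "circ (- a) c = - circ a c"
    "circ a (b + c) = circ a b + circ a c" "circ a (scaleA k c) = scaleA k (circ a c)"
    "circ a (- c) = - circ a c"
    "br (a + b) c = br a c + br b c" "br (scaleA k a) c = scaleA k (br a c)"
    "br (- a) c = - br a c"
    "br a (b + c) = br a b + br a c" "br a (scaleA k c) = scaleA k (br a c)"
    "br a (- c) = - br a c"
    by (fact *[THEN module_hom.add] *[THEN module_hom.scale] *[THEN module_hom.neg])+
qed

lemma bilinear_circ_hat: "bilinear_on scale_hat scale_hat scale_hat carrier_hat carrier_hat carrier_hat circ_hat"
  unfolding bilinear_on_def linear_on_def
  by (auto simp: sd_circ_def sd_scale_def product_simps dual_map_def dual_simps action_simps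
      dual_scale_def fun_eq_iff algebra_simps intro!: dual_closed dualI)

lemma bilinear_br_hat: "bilinear_on scale_hat scale_hat scale_hat carrier_hat carrier_hat carrier_hat br_hat"
  unfolding bilinear_on_def linear_on_def
  by (auto simp: sd_br_def sd_scale_def product_simps dual_map_def dual_simps action_simps
      dual_scale_def fun_eq_iff algebra_simps intro!: dual_closed dualI)

lemma coord_in_dual: "coord v \<in> dual_space scaleV"
  unfolding dual_basis_def dual_iff
  by (rule finV.linear_representation[OF finV.independent_Basis finV.span_Basis])

lemma basis_expansion: "(\<Sum>v\<in>BasisV. scaleV (coord v u) v) = u"
  unfolding dual_basis_def
  by (rule finV.sum_representation_eq)
    (simp_all add: finV.independent_Basis finV.span_Basis finV.finite_Basis)

lemma dual_basis_expansion:
  assumes "f \<in> dual_space scaleV"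
  shows "(\<Sum>v\<in>BasisV. f v * coord v u) = f u"
proof -
  have "f u = f (\<Sum>v\<in>BasisV. scaleV (coord v u) v)" by (simp only: basis_expansion)
  also have "\<dots> = (\<Sum>v\<in>BasisV. f v * coord v u)"
    using assms
    by (simp add: dual_iff module_hom.sum[OF module_hom_linearI] dual_simps[OF assms] mult.commute)
  finally show ?thesis by simp
qed

text \<open>The basis of \<open>A \<oplus> V\<^sup>*\<close> made of the basis of \<open>A\<close> and the dual basis of \<open>V\<^sup>*\<close>, with its coordinates:
  the coordinate along the dual basis vector of \<open>v\<close> is evaluation at \<open>v\<close>.\<close>

definition frame :: "'a + 'v \<Rightarrow> 'a \<times> ('v \<Rightarrow> 'k)"
  where "frame = case_sum (\<lambda>a. (a, 0)) (\<lambda>v. (0, coord v))"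

definition coframe :: "'a + 'v \<Rightarrow> 'a \<times> ('v \<Rightarrow> 'k) \<Rightarrow> 'k"
  where "coframe = case_sum (\<lambda>a. pair_functional (coordA a) 0) (pair_functional (\<lambda>_. 0))"

lemma sd_scale_vector_space: "vector_space scale_hat"
  by unfold_locales
    (auto simp: sd_scale_def dual_scale_def fun_eq_iff algebra_simps finA.scale_right_distrib
      finA.scale_left_distrib)

lemma frame_expansion_hat:
  assumes "x \<in> carrier_hat"
  shows "x = (\<Sum>i\<in>BasisA <+> BasisV. scale_hat (coframe i x) (frame i))"
proof -
  have x: "snd x \<in> dual_space scaleV" using assms by auto
  have "(\<Sum>a\<in>BasisA. scaleA (coordA a (fst x)) a) = fst x"
    by (rule finA.sum_representation_eq)
      (simp_all add: finA.independent_Basis finA.span_Basis finA.finite_Basis)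
  moreover have "(\<Sum>v\<in>BasisV. dual_scale (snd x v) (coord v)) = snd x"
    by (rule ext) (simp add: sum_apply dual_scale_def dual_basis_expansion[OF x])
  ultimately show ?thesis
    by (simp add: dual_scale_zero sum.Plus finA.finite_Basis finV.finite_Basis prod_eq_iff fst_sum snd_sum
        frame_def coframe_def pair_functional_def sd_scale_def dual_simps[OF x])
qed

sublocale hat: framed_tensor_factor scale_hat carrier_hat "BasisA <+> BasisV" frame coframe functionals
proof (intro framed_tensor_factor.intro tensor_factor.intro tensor_factor_axioms.intro
    framed_tensor_factor_axioms.intro sd_scale_vector_space)
  interpret hat: vector_space scale_hat by (rule sd_scale_vector_space)
  show "hat.subspace carrier_hat"
    by (auto simp: hat.subspace_def sd_scale_def zero_prod_def intro!: dual_closed)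
  show "finite (BasisA <+> BasisV)" by (simp add: finA.finite_Basis finV.finite_Basis)
  show "frame i \<in> carrier_hat" for i
    by (auto simp: frame_def dual_closed coord_in_dual split: sum.split)
  show "x = (\<Sum>i\<in>BasisA <+> BasisV. scale_hat (coframe i x) (frame i))" if "x \<in> carrier_hat" for x
    using that by (rule frame_expansion_hat)
  have zero: "Vector_Spaces.linear scaleA (*) (\<lambda>_. 0)"
    using finA.vector_space_axioms vector_space_field by (simp add: Vector_Spaces.linear_iff)
  show "coframe i \<in> functionals" for i
    using finA.linear_representation[OF finA.independent_Basis finA.span_Basis] zero
    by (cases i) (auto simp: coframe_def functionals_def)
  show "linear_on scale_hat (*) carrier_hat UNIV f" if "f \<in> functionals" for f
    using that
    by (auto simp: functionals_def linear_on_def pair_functional_def sd_scale_def dual_scale_def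
        linear_simps algebra_simps)
qed

definition basis_list :: "'v list"
  where "basis_list = (SOME vs. set vs = BasisV \<and> distinct vs)"

lemma basis_list: "set basis_list = BasisV" "distinct basis_list"
  using someI_ex[OF finite_distinct_list[OF finV.finite_Basis]] by (auto simp: basis_list_def)

lemma sum_basis_list: "(\<Sum>v\<leftarrow>basis_list. g v) = (\<Sum>v\<in>BasisV. g v)"
  using sum_list_distinct_conv_sum_set[OF basis_list(2), of g] by (simp add: basis_list(1))

text \<open>An expression for \<open>r\<^sub>T - \<tau> r\<^sub>T\<close> as a sum of pure tensors. As these carry no coefficients, the
  minus sign is put into the first factor.\<close>

definition skew_pairs :: "(('a \<times> ('v \<Rightarrow> 'k)) \<times> ('a \<times> ('v \<Rightarrow> 'k))) list"
  where "skew_pairs = map (\<lambda>v. ((T v, 0), (0, coord v))) basis_list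
    @ map (\<lambda>v. (scale_hat (- 1) (0, coord v), (T v, 0))) basis_list"

lemma skew_pairs_in: "set skew_pairs \<subseteq> carrier_hat \<times> carrier_hat"
  by (auto simp: skew_pairs_def sd_scale_def dual_closed coord_in_dual)

lemma skew_tensor_eq:
  "tensor_diff (hom_tensor scaleA scaleV BasisV T) (tensor_flip (hom_tensor scaleA scaleV BasisV T))
    = sum_tensor scale_hat carrier_hat skew_pairs"
proof -
  let ?t = "\<lambda>v. (T v, 0) :: 'a \<times> ('v \<Rightarrow> 'k)" and ?c = "\<lambda>v. (0, coord v) :: 'a \<times> ('v \<Rightarrow> 'k)"
  let ?flip = "Poly_Mapping.map_key prod.swap
    :: ((('a \<times> ('v \<Rightarrow> 'k)) \<times> ('a \<times> ('v \<Rightarrow> 'k))) \<Rightarrow>\<^sub>0 'k) \<Rightarrow> _"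
  have inj: "inj (prod.swap :: ('a \<times> ('v \<Rightarrow> 'k)) \<times> ('a \<times> ('v \<Rightarrow> 'k)) \<Rightarrow> _)" by simp
  have flip_single: "?flip (Poly_Mapping.single (x, y) c) = Poly_Mapping.single (y, x) c" for x y c
    using map_key_single[OF inj, of "(y, x)" c] by simp
  have flip: "?flip (\<Sum>v\<in>BasisV. Poly_Mapping.single (?t v, ?c v) 1)
    = (\<Sum>v\<in>BasisV. Poly_Mapping.single (?c v, ?t v) 1)"
  proof -
    have "?flip (\<Sum>v\<in>S. Poly_Mapping.single (?t v, ?c v) 1)
      = (\<Sum>v\<in>S. Poly_Mapping.single (?c v, ?t v) 1)" if "finite S" for S
      using that by (induction S) (simp_all add: map_key_plus[OF inj] flip_single)
    then show ?thesis using finV.finite_Basis .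
  qed
  have "tensor_diff (hom_tensor scaleA scaleV BasisV T) (tensor_flip (hom_tensor scaleA scaleV BasisV T))
    = tensor2 scale_hat carrier_hat ((\<Sum>v\<in>BasisV. Poly_Mapping.single (?t v, ?c v) 1)
        - (\<Sum>v\<in>BasisV. Poly_Mapping.single (?c v, ?t v) 1))"
    by (simp only: hom_tensor_def hat.tensor_flip_tensor2 hat.tensor_diff_tensor2 flip)
  also have "\<dots> = sum_tensor scale_hat carrier_hat skew_pairs"
    unfolding sum_tensor_def
  proof (rule hat.tensor2_eqI)
    \<comment> \<open>The two formal sums differ by the relation that moves the scalar \<open>- 1\<close> out of the first factor.\<close>
    have "Poly_Mapping.single (scale_hat (- 1) (?c v), ?t v) 1
        - Poly_Mapping.single (?c v, ?t v) (- 1) \<in> null2 scale_hat carrier_hat" for v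
      unfolding null2_def
      by (rule free.span_base, rule UnI1, rule UnI2) (use coord_in_dual dual_closed in blast)
    then have "- (\<Sum>v\<in>BasisV. Poly_Mapping.single (scale_hat (- 1) (?c v), ?t v) 1
        - Poly_Mapping.single (?c v, ?t v) (- 1)) \<in> null2 scale_hat carrier_hat"
      by (intro free.subspace_neg[OF hat.subspace_null(1)] free.subspace_sum[OF hat.subspace_null(1)])
    moreover have eq: "(\<Sum>v\<in>BasisV. Poly_Mapping.single (?t v, ?c v) 1)
        - (\<Sum>v\<in>BasisV. Poly_Mapping.single (?c v, ?t v) 1)
        - (\<Sum>(x, y)\<leftarrow>skew_pairs. Poly_Mapping.single (x, y) 1)
      = - (\<Sum>v\<in>BasisV. Poly_Mapping.single (scale_hat (- 1) (?c v), ?t v) 1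
        - Poly_Mapping.single (?c v, ?t v) (- 1))"
      by (simp add: skew_pairs_def o_def sum_basis_list sum_subtractf single_uminus sum_negf sum.distrib)
    ultimately show "(\<Sum>v\<in>BasisV. Poly_Mapping.single (?t v, ?c v) 1)
        - (\<Sum>v\<in>BasisV. Poly_Mapping.single (?c v, ?t v) 1)
        - (\<Sum>(x, y)\<leftarrow>skew_pairs. Poly_Mapping.single (x, y) 1) \<in> null2 scale_hat carrier_hat"
      by (simp only: eq)
  qed
  finally show ?thesis .
qed

lemma compose_T_in_dual:
  "Vector_Spaces.linear scaleA (*) \<alpha> \<Longrightarrow> (\<lambda>v. \<alpha> (T v)) \<in> dual_space scaleV"
  by (rule dualI) (simp_all add: T.add T.scale linear_simps)

lemma T_expansion: "(\<Sum>v\<in>BasisV. scaleA (coord v u) (T v)) = T u"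
proof -
  have "T u = T (\<Sum>v\<in>BasisV. scaleV (coord v u) v)" by (simp only: basis_expansion)
  then show ?thesis by (simp add: T.sum T.scale)
qed

text \<open>Contracting \<open>r\<^sub>T\<close> with \<open>u \<in> V\<close> on the right gives \<open>T u\<close>, and with \<open>\<alpha> \<in> A\<^sup>*\<close> on the left gives
  \<open>\<alpha> \<circ> T \<in> V\<^sup>*\<close>. The two contractions of \<open>r\<^sub>T - \<tau> r\<^sub>T\<close> are opposite because this tensor is skew.\<close>

lemma contract_skew_pairs:
  assumes \<alpha>: "Vector_Spaces.linear scaleA (*) \<alpha>"
  shows "hat.contract_left (pair_functional \<alpha> u) skew_pairs = (- T u, \<lambda>v. \<alpha> (T v))"
    and "hat.contract_right (pair_functional \<alpha> u) skew_pairs = (T u, \<lambda>v. - \<alpha> (T v))"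
proof -
  have \<alpha>0: "\<alpha> 0 = 0" using \<alpha> by (simp add: linear_simps)
  have "(\<Sum>v\<in>BasisV. dual_scale (\<alpha> (T v)) (coord v)) = (\<lambda>v. \<alpha> (T v))"
    and "(\<Sum>v\<in>BasisV. dual_scale (\<alpha> (T v)) (dual_scale (- 1) (coord v))) = (\<lambda>v. - \<alpha> (T v))"
    using dual_basis_expansion[OF compose_T_in_dual[OF \<alpha>]]
    by (simp_all add: fun_eq_iff sum_apply dual_scale_def sum_negf)
  moreover have "(\<Sum>v\<in>BasisV. scaleA (dual_scale (- 1) (coord v) u) (T v)) = - T u"
    by (simp add: dual_scale_def sum_negf T_expansion)
  ultimately show "hat.contract_left (pair_functional \<alpha> u) skew_pairs = (- T u, \<lambda>v. \<alpha> (T v))"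
    and "hat.contract_right (pair_functional \<alpha> u) skew_pairs = (T u, \<lambda>v. - \<alpha> (T v))"
    by (simp_all add: hat.contract_left_def hat.contract_right_def skew_pairs_def o_def
        sum_basis_list prod_eq_iff fst_sum snd_sum sd_scale_def pair_functional_def \<alpha>0
        T_expansion dual_scale_zero)
qed

definition defect_circ :: "'v \<Rightarrow> 'v \<Rightarrow> 'a"
  where "defect_circ u v = circ (T u) (T v) - T (l (T u) v + r (T v) u)"

definition defect_br :: "'v \<Rightarrow> 'v \<Rightarrow> 'a"
  where "defect_br u v = br (T u) (T v) - T (\<rho> (T u) v - \<rho> (T v) u)"

lemma o_operator_iff_defects:
  "o_operator scaleV scaleA circ br l r \<rho> T \<longleftrightarrow>
    (\<forall>u v. defect_circ u v = 0 \<and> defect_br u v = 0)"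
  using T.linear_axioms by (auto simp: o_operator_def defect_circ_def defect_br_def)

text \<open>The dual actions turn the \<open>V\<^sup>*\<close>-components of the products into terms such as
  \<open>\<beta> (T (l (T u) z + r (T u) z))\<close>. Sorted by the functional applied last, the terms with \<open>\<gamma>\<close>, \<open>\<alpha>\<close> and
  \<open>\<beta>\<close> assemble to defects of the condition on \<open>T\<close>. The choice of \<open>l\<^sup>* + r\<^sup>*\<close> and
  \<open>- r\<^sup>*\<close> as dual actions is what makes them match.\<close>

lemma N_value:
  fixes u w z :: 'v
  assumes \<alpha>: "Vector_Spaces.linear scaleA (*) \<alpha>" and \<beta>: "Vector_Spaces.linear scaleA (*) \<beta>"
    and \<gamma>: "Vector_Spaces.linear scaleA (*) \<gamma>"
  defines "f \<equiv> pair_functional \<alpha> u" and "g \<equiv> pair_functional \<beta> w" and "h \<equiv> pair_functional \<gamma> z"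
  shows "h (circ_hat (hat.contract_left f skew_pairs) (hat.contract_left g skew_pairs))
    + g (circ_hat (hat.contract_left f skew_pairs) (hat.contract_right h skew_pairs)
        + circ_hat (hat.contract_right h skew_pairs) (hat.contract_left f skew_pairs))
    + f (circ_hat (hat.contract_right h skew_pairs) (hat.contract_right g skew_pairs))
    = \<gamma> (defect_circ u w) + \<alpha> (defect_circ z w) - \<beta> (defect_circ u z + defect_circ z u)"
  unfolding f_def g_def h_def contract_skew_pairs[OF \<alpha>] contract_skew_pairs[OF \<beta>]
    contract_skew_pairs[OF \<gamma>]
  by (simp add: pair_functional_def sd_circ_def dual_map_def defect_circ_def product_simps
      action_simps T.add T.diff T.neg linear_simps[OF \<alpha>] linear_simps[OF \<beta>] linear_simps[OF \<gamma>])

lemma C_value: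
  fixes u w z :: 'v
  assumes \<alpha>: "Vector_Spaces.linear scaleA (*) \<alpha>" and \<beta>: "Vector_Spaces.linear scaleA (*) \<beta>"
    and \<gamma>: "Vector_Spaces.linear scaleA (*) \<gamma>"
  defines "f \<equiv> pair_functional \<alpha> u" and "g \<equiv> pair_functional \<beta> w" and "h \<equiv> pair_functional \<gamma> z"
  shows "f (br_hat (hat.contract_right g skew_pairs) (hat.contract_right h skew_pairs))
    + g (br_hat (hat.contract_left f skew_pairs) (hat.contract_right h skew_pairs))
    + h (br_hat (hat.contract_left f skew_pairs) (hat.contract_left g skew_pairs))
    = \<gamma> (defect_br u w) + \<alpha> (defect_br w z) - \<beta> (defect_br u z)"
  unfolding f_def g_def h_def contract_skew_pairs[OF \<alpha>] contract_skew_pairs[OF \<beta>]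
    contract_skew_pairs[OF \<gamma>]
  by (simp add: pair_functional_def sd_br_def dual_map_def defect_br_def product_simps
      action_simps T.add T.diff T.neg linear_simps[OF \<alpha>] linear_simps[OF \<beta>] linear_simps[OF \<gamma>])

lemma coordinates_separate:
  assumes "\<And>\<gamma>. Vector_Spaces.linear scaleA (*) \<gamma> \<Longrightarrow> \<gamma> a = 0"
  shows "a = 0"
proof -
  have "(\<Sum>b\<in>BasisA. scaleA (coordA b a) b) = a"
    by (rule finA.sum_representation_eq)
      (simp_all add: finA.independent_Basis finA.span_Basis finA.finite_Basis)
  moreover have "coordA b a = 0" for b
    by (rule assms, rule finA.linear_representation[OF finA.independent_Basis finA.span_Basis])
  ultimately show ?thesis by simp
qed

theorem gdybe_iff_o_operator:
  "gdybe_solution scale_hat carrier_hat circ_hat br_hat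
      (tensor_diff (hom_tensor scaleA scaleV BasisV T)
        (tensor_flip (hom_tensor scaleA scaleV BasisV T)))
    \<longleftrightarrow> o_operator scaleV scaleA circ br l r \<rho> T"
  (is "?gdybe \<longleftrightarrow> ?oop")
proof -
  have "?gdybe \<longleftrightarrow> (\<forall>\<alpha> u. Vector_Spaces.linear scaleA (*) \<alpha> \<longrightarrow>
      (\<forall>\<beta> w. Vector_Spaces.linear scaleA (*) \<beta> \<longrightarrow> (\<forall>\<gamma> z. Vector_Spaces.linear scaleA (*) \<gamma> \<longrightarrow>
      \<gamma> (defect_circ u w) + \<alpha> (defect_circ z w) - \<beta> (defect_circ u z + defect_circ z u) = 0 \<and>
      \<gamma> (defect_br u w) + \<alpha> (defect_br w z) - \<beta> (defect_br u z) = 0)))"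
    (is "_ \<longleftrightarrow> ?R")
    unfolding skew_tensor_eq
      hat.gdybe_solution_iff[OF bilinear_circ_hat bilinear_br_hat skew_pairs_in]
      ball_functionals
    by (intro arg_cong[where f = All] ext imp_cong refl) (simp only: N_value C_value)
  also have "?R \<longleftrightarrow> (\<forall>u v. defect_circ u v = 0 \<and> defect_br u v = 0)"
  proof
    assume R: ?R
    have zero: "Vector_Spaces.linear scaleA (*) (\<lambda>_. 0)"
      using finA.vector_space_axioms vector_space_field by (simp add: Vector_Spaces.linear_iff)
    \<comment> \<open>With \<open>\<alpha> = \<beta> = 0\<close> only the defects at \<open>(u, v)\<close> remain.\<close>
    have "\<gamma> (defect_circ u v) = 0 \<and> \<gamma> (defect_br u v) = 0"
      if "Vector_Spaces.linear scaleA (*) \<gamma>" for \<gamma> u v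
      using R[rule_format, OF zero zero that, of u v] by simp
    then show "\<forall>u v. defect_circ u v = 0 \<and> defect_br u v = 0"
      using coordinates_separate by blast
  next
    assume "\<forall>u v. defect_circ u v = 0 \<and> defect_br u v = 0"
    then show ?R by (simp add: linear_simps)
  qed
  finally show ?thesis unfolding o_operator_iff_defects .
qed

end

theorem theorem3p11:
  fixes scaleA :: "'k::field_char_0 \<Rightarrow> 'a::ab_group_add \<Rightarrow> 'a"
    and scaleV :: "'k \<Rightarrow> 'v::ab_group_add \<Rightarrow> 'v"
    and circ br :: "'a \<Rightarrow> 'a \<Rightarrow> 'a"
    and l r \<rho> :: "'a \<Rightarrow> 'v \<Rightarrow> 'v"
    and T :: "'v \<Rightarrow> 'a"
    and BasisA :: "'a set" and BasisV :: "'v set"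
  assumes "finite_dimensional_vector_space scaleA BasisA"
    and "finite_dimensional_vector_space scaleV BasisV"
    and "gd_algebra scaleA UNIV circ br"
    and "gd_representation scaleA UNIV circ br scaleV UNIV l r \<rho>"
    and "Vector_Spaces.linear scaleV scaleA T"
  shows "gdybe_solution (sd_scale scaleA dual_scale) (UNIV \<times> dual_space scaleV)
      (sd_circ circ (dual_map l + dual_map r) (- dual_map r))
      (sd_br br (dual_map \<rho>))
      (tensor_diff (hom_tensor scaleA scaleV BasisV T)
        (tensor_flip (hom_tensor scaleA scaleV BasisV T)))
    \<longleftrightarrow> o_operator scaleV scaleA circ br l r \<rho> T"
  using assms
  by (intro linear_map_into_gd_algebra.gdybe_iff_o_operator linear_map_into_gd_algebra.intro)

end
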